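(* For any ergodic conservative dynamical system $(X,\mathcal A,\mu,T)$ with $\mu(X)=\infty$ (as in the context), there exists a $T$-point process $N$ with intensity $\mu$ (defined on some probability preserving system $(\Omega,\mathscr F,\mathbb P,S)$) such that, with probability $1$, for any $x\in N(\omega)$, $$N(\omega)\left(\{T^kx:\ k\in\mathbb Z\}\right)=\infty.$$
   Context: Setting. $X$ is a complete separable metric space with Borel $\sigma$-algebra $\mathcal A$; $\mu$ is a measure on $(X,\mathcal A)$ that is boundedly finite (finite on bounded Borel sets); $T:X\to X$ is invertible and preserves $\mu$. $X^*$ is the set of boundedly finite simple counting measures $\xi=\sum_{i\in I}\delta_{x_i}$ ($I$ at most countable, $x_i\ne x_j$ for $i\neq j$), and $\mathcal A^*$ is the $\sigma$-algebra on $X^*$ generated by the maps $\xi\mapsto \xi(A)$, $A$ bounded Borel. "$x\in \xi$" means $\xi(\{x\})=1$. $T$-point process. $(\Omega,\mathscr F,\mathbb P)$ is a probability space and $S$ an invertible measure preserving transformation of it. A $T$-point process defined on $(\Omega,\mathscr F,\mathbb P,S)$ is a measurable map $N:\Omega\to X^*$ such that (i) for each $A\in\mathcal A$ with $\mu(A)=0$, $N(\omega)(A)=0$ for $\mathbb P$-a.e. $\omega$; (ii) for $\mathbb P$-a.e. $\omega$, for all $A\in\mathcal A$, $N(S\omega)(A)=N(\omega)(T^{-1}A)$. Its intensity is the measure $A\mapsto\mathbb E[N(A)]$. *)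

theory Defs
  imports "HOL-Probability.Probability"
begin

definition boundedly_finite :: "'a::metric_space measure \<Rightarrow> bool" where
  "boundedly_finite M \<longleftrightarrow> (\<forall>A\<in>sets borel. bounded A \<longrightarrow> emeasure M A < \<infinity>)"

text \<open>Invertibility of a transformation is understood, as usual in ergodic theory, as being a
  bijection that is measurable in both directions.\<close>

definition invertible_mpt :: "'w measure \<Rightarrow> ('w \<Rightarrow> 'w) \<Rightarrow> bool" where
  "invertible_mpt M T \<longleftrightarrow>
     bij_betw T (space M) (space M) \<and> T \<in> measurable M M \<and>
     inv_into (space M) T \<in> measurable M M \<and> distr M M T = M"

definition ergodic_map :: "'w measure \<Rightarrow> ('w \<Rightarrow> 'w) \<Rightarrow> bool" where
  "ergodic_map M T \<longleftrightarrow>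
     (\<forall>A\<in>sets M. T -` A \<inter> space M = A \<longrightarrow> emeasure M A = 0 \<or> emeasure M (space M - A) = 0)"

definition wandering_set :: "'w measure \<Rightarrow> ('w \<Rightarrow> 'w) \<Rightarrow> 'w set \<Rightarrow> bool" where
  "wandering_set M T W \<longleftrightarrow>
     W \<in> sets M \<and> disjoint_family (\<lambda>n::nat. (T ^^ n) -` W \<inter> space M)"

definition conservative_map :: "'w measure \<Rightarrow> ('w \<Rightarrow> 'w) \<Rightarrow> bool" where
  "conservative_map M T \<longleftrightarrow> (\<forall>W. wandering_set M T W \<longrightarrow> emeasure M W = 0)"

text \<open>Simple counting measures: since the atoms are pairwise distinct, the family indexed by
  \<open>I\<close> is given by the countable set \<open>C\<close> of its values; \<open>return borel x\<close> is the Dirac mass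
  at \<open>x\<close>, and the integral against \<open>count_space C\<close> is the sum over \<open>C\<close>.\<close>

definition point_configurations :: "'a::metric_space measure set" where
  "point_configurations =
     {\<xi>. sets \<xi> = sets borel \<and> boundedly_finite \<xi> \<and>
        (\<exists>C. countable C \<and>
           (\<forall>A\<in>sets borel. emeasure \<xi> A = (\<integral>\<^sup>+x. emeasure (return borel x) A \<partial>count_space C)))}"

text \<open>The configuration space with the \<open>\<sigma>\<close>-algebra generated by the evaluations on bounded
  Borel sets. It is an element of type \<open>measure\<close> only to carry this \<open>\<sigma>\<close>-algebra, as for
  \<^const>\<open>subprob_algebra\<close>.\<close>

definition configuration_algebra :: "'a::metric_space measure measure" where
  "configuration_algebra =
     (SUP A \<in> {A \<in> sets borel. bounded A}.
        vimage_algebra point_configurations (\<lambda>\<xi>. emeasure \<xi> A) borel)"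

definition point_process ::
  "'a::metric_space measure \<Rightarrow> ('a \<Rightarrow> 'a) \<Rightarrow> 'w measure \<Rightarrow> ('w \<Rightarrow> 'w) \<Rightarrow> ('w \<Rightarrow> 'a measure) \<Rightarrow> bool"
  where
  "point_process \<mu> T P S N \<longleftrightarrow>
     prob_space P \<and> invertible_mpt P S \<and>
     N \<in> measurable P configuration_algebra \<and>
     (\<forall>A\<in>sets borel. emeasure \<mu> A = 0 \<longrightarrow> (AE \<omega> in P. emeasure (N \<omega>) A = 0)) \<and>
     (AE \<omega> in P. \<forall>A\<in>sets borel. emeasure (N (S \<omega>)) A = emeasure (N \<omega>) (T -` A))"

definition intensity :: "'w measure \<Rightarrow> ('w \<Rightarrow> 'a::metric_space measure) \<Rightarrow> 'a measure" where
  "intensity P N = measure_of UNIV (sets borel) (\<lambda>A. \<integral>\<^sup>+\<omega>. emeasure (N \<omega>) A \<partial>P)"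

definition int_iterate :: "('a \<Rightarrow> 'a) \<Rightarrow> int \<Rightarrow> 'a \<Rightarrow> 'a" where
  "int_iterate T k = (if 0 \<le> k then T ^^ nat k else inv T ^^ nat (- k))"

text \<open>An existential statement of HOL cannot range over types, so the sample points of the
  probability space are drawn from one fixed type, large enough to hold the configurations of
  points of \<open>'a\<close> carrying marks. The type puts no restriction on the probability space itself:
  its carrier, \<open>\<sigma>\<close>-algebra and probability remain arbitrary.\<close>

type_synonym 'a sample = "('a \<times> (nat \<Rightarrow> real)) measure"

end

theory Submission
  imports Defs
begin

text \<open>The process is a Poisson process of clusters, each cluster being an infinite subset of one orbit.

Mark the points of \<open>X\<close> with sequences of independent fair coins. A finite set \<open>F\<close> of indices acts on a
marked point \<open>(x, \<epsilon>)\<close> by flipping the coins in \<open>F\<close> and moving \<open>x\<close> along its orbit by the sum over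
\<open>i \<in> F\<close> of \<open>n i\<close> or \<open>- n i\<close>, according to the direction in which coin \<open>i\<close> is flipped. The displacement
is a cocycle, so the finite sets, with symmetric difference as addition, act as a group; the action
preserves \<open>\<mu> \<Otimes> coin\<close> and commutes with \<open>T \<times> id\<close>. The positions in the group orbit of \<open>(x, \<epsilon>)\<close> form the
cluster of \<open>(x, \<epsilon>)\<close>. Choosing one representative in every group orbit and throwing a Poisson process
on the representatives, every marked point is covered once, so the superposition of the clusters has
intensity \<open>\<mu>\<close>, although every single cluster is infinite.

Representatives exist, in the fractional form of a weight whose sum over almost every group orbit
is \<open>1\<close>, as soon as some integrable \<open>f > 0\<close> has finite sums over the group orbits
(\<open>orbit_sum_f_finite\<close>); the weight is \<open>f\<close> divided by its orbit sum. This is where ergodicity and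
\<open>\<mu>(X) = \<infinity>\<close> enter. By the maximal inequality the averages of \<open>f \<circ> T\<^sup>k\<close> tend to \<open>0\<close> almost everywhere
(\<open>average_tendsto_0\<close>), so the correlations \<open>\<integral> f \<cdot> f \<circ> T\<^sup>k\<close> are as small as desired on arbitrarily long
windows of times \<open>k\<close>, and \<open>n\<close> can be chosen so sparse that the correlations along all displacements
are summable (\<open>obtain_sparse_times\<close>). Decay of correlations also makes almost every point aperiodic
(\<open>periodic_null\<close>), so clusters are infinite; together with conservativity it excludes atoms
(\<open>emeasure_singleton\<close>), so different clusters are disjoint.

The law of a random set is determined by the probabilities that it avoids given Borel sets, since
these void events are stable under intersection (\<open>void_algebra_measure_eqI\<close>). For the union of the
clusters the void probability of \<open>A\<close> depends only on the integral of the weight over the union of the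
group orbits that meet \<open>A\<close> (\<open>void_probability\<close>). Integrals over invariant sets do not depend on the
choice of the weight (\<open>weighted_invariant_set\<close>), and \<open>T \<times> id\<close> merely replaces the weight by another
one. Hence the law is invariant under taking images by \<open>T\<close>, and this is the transformation \<open>S\<close>.\<close>

section \<open>The maximal inequality\<close>

text \<open>The maximum over \<open>k \<le> n\<close> of the sums of \<open>f\<close> over the first \<open>k\<close> points of the orbit, the empty sum included. The recursion
is the form in which Garsia's proof of the maximal inequality uses it.\<close>

primrec max_orbit_sum :: "('w \<Rightarrow> real) \<Rightarrow> ('w \<Rightarrow> 'w) \<Rightarrow> nat \<Rightarrow> 'w \<Rightarrow> real" where
  "max_orbit_sum f T 0 x = 0"
| "max_orbit_sum f T (Suc n) x = max 0 (f x + max_orbit_sum f T n (T x))"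

lemma max_orbit_sum_nonneg: "0 \<le> max_orbit_sum f T n x"
  by (cases n) auto

lemma max_orbit_sum_mono_Suc: "max_orbit_sum f T n x \<le> max_orbit_sum f T (Suc n) x"
proof (induction n arbitrary: x)
  case (Suc n)
  show ?case using Suc[of "T x"] by (auto simp: max_def)
qed (simp add: max_orbit_sum_nonneg)

lemma max_orbit_sum_mono: "m \<le> n \<Longrightarrow> max_orbit_sum f T m x \<le> max_orbit_sum f T n x"
  by (rule lift_Suc_mono_le[of "\<lambda>n. max_orbit_sum f T n x"]) (rule max_orbit_sum_mono_Suc)

lemma sum_orbit_Suc:
  fixes f :: "'w \<Rightarrow> 'b::comm_monoid_add"
  shows "(\<Sum>k<Suc n. f ((T ^^ k) x)) = f x + (\<Sum>k<n. f ((T ^^ k) (T x)))"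
  by (simp add: sum.lessThan_Suc_shift funpow_swap1 del: sum.lessThan_Suc)

lemma sum_orbit_le_max_orbit_sum: "(\<Sum>k<n. f ((T ^^ k) x)) \<le> max_orbit_sum f T n x"
proof (induction n arbitrary: x)
  case (Suc n)
  show ?case unfolding sum_orbit_Suc using Suc[of "T x"] by auto
qed simp

locale measure_preserving =
  fixes M :: "'w measure" and T :: "'w \<Rightarrow> 'w"
  assumes measurable_T [measurable]: "T \<in> measurable M M"
    and distr_T: "distr M M T = M"
begin

lemma measurable_funpow [measurable]: "T ^^ k \<in> measurable M M"
  by (induction k) (simp_all add: id_def)

lemma distr_funpow: "distr M M (T ^^ k) = M"
proof (induction k)
  case 0
  show ?case by (simp add: distr_id2[unfolded id_def[symmetric]])
next
  case (Suc k)
  have "distr M M (T ^^ Suc k) = distr (distr M M (T ^^ k)) M T"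
    by (simp add: distr_distr comp_def)
  also have "\<dots> = M" by (simp only: Suc distr_T)
  finally show ?case .
qed

lemma nn_integral_funpow:
  assumes [measurable]: "g \<in> borel_measurable M"
  shows "(\<integral>\<^sup>+x. g ((T ^^ k) x) \<partial>M) = (\<integral>\<^sup>+x. g x \<partial>M)"
  by (subst (2) distr_funpow[of k, symmetric]) (simp add: nn_integral_distr)

lemma integrable_funpow:
  fixes g :: "'w \<Rightarrow> real"
  assumes "integrable M g"
  shows "integrable M (\<lambda>x. g ((T ^^ k) x))"
  using assms by (intro integrable_distr[of "T ^^ k" M M g]) (simp_all add: distr_funpow)

lemma integral_T:
  fixes g :: "'w \<Rightarrow> real"
  assumes "integrable M g"
  shows "(\<integral>x. g (T x) \<partial>M) = (\<integral>x. g x \<partial>M)"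
  using assms by (subst (2) distr_T[symmetric]) (simp add: integral_distr)

lemma integrable_T:
  fixes g :: "'w \<Rightarrow> real"
  assumes "integrable M g"
  shows "integrable M (\<lambda>x. g (T x))"
  using integrable_funpow[OF assms, of 1] by simp

lemma integrable_max_orbit_sum:
  assumes "integrable M f"
  shows "integrable M (max_orbit_sum f T n)"
proof (induction n)
  case (Suc n)
  have "integrable M (\<lambda>x. max 0 (f x + max_orbit_sum f T n (T x)))"
    by (intro Bochner_Integration.integrable_max integrable_zero Bochner_Integration.integrable_add
        assms integrable_T Suc)
  then show ?case by simp
qed simp

text \<open>Garsia's argument: where the maximum \<open>S\<close> is positive, the recursion gives \<open>S \<le> f + S \<circ> T\<close>, and elsewhere
\<open>S - S \<circ> T \<le> 0\<close>. Integrating, \<open>S\<close> and \<open>S \<circ> T\<close> cancel.\<close>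

lemma maximal_ergodic_inequality:
  assumes f: "integrable M f"
  shows "0 \<le> (\<integral>x. indicator {x. 0 < max_orbit_sum f T n x} x * f x \<partial>M)"
proof (cases n)
  case 0
  then show ?thesis by simp
next
  case (Suc m)
  let ?S = "max_orbit_sum f T n" and ?I = "\<lambda>x. indicator {x. 0 < max_orbit_sum f T n x} x :: real"
  note int = integrable_max_orbit_sum[OF f, of n]
  have [measurable]: "?S \<in> borel_measurable M" "f \<in> borel_measurable M"
    using int f by auto
  have P: "{x \<in> space M. 0 < ?S x} \<in> sets M" by measurable
  have ind: "integrable M (\<lambda>x. ?I x * f x)"
  proof -
    have "integrable M (\<lambda>x. f x * indicator {x \<in> space M. 0 < ?S x} x)"
      using P f by (rule integrable_real_mult_indicator)
    then show ?thesis
      by (rule Bochner_Integration.integrable_cong[THEN iffD1, rotated 2]) (auto simp: indicator_def)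
  qed
  have le: "?S x - ?S (T x) \<le> ?I x * f x" for x
  proof (cases "0 < ?S x")
    case True
    then have "?S x = f x + max_orbit_sum f T m (T x)"
      by (auto simp: Suc max_def split: if_splits)
    also have "\<dots> \<le> f x + ?S (T x)"
      using max_orbit_sum_mono[of m n f T "T x"] Suc by simp
    finally show ?thesis using True by simp
  next
    case False
    then have "?S x = 0" using max_orbit_sum_nonneg[of f T n x] by simp
    then show ?thesis using max_orbit_sum_nonneg[of f T n "T x"] by simp
  qed
  have "0 = (\<integral>x. ?S x - ?S (T x) \<partial>M)"
    using int by (simp add: integral_T integrable_T)
  also have "\<dots> \<le> (\<integral>x. ?I x * f x \<partial>M)"
    by (intro integral_mono Bochner_Integration.integrable_diff integrable_T int ind le)
  finally show ?thesis .
qed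

text \<open>The previous inequality applied to \<open>f - c\<close>. Since constants are not integrable over an infinite
measure, \<open>c\<close> is subtracted on the set \<open>E\<close> of finite measure only; this decreases the orbit sums by at
most \<open>c * n\<close>, which is all that is needed on \<open>E\<close>.\<close>

lemma maximal_inequality_weak_type:
  assumes f: "integrable M f" "\<And>x. 0 \<le> f x" and "0 < c"
    and E: "E \<in> sets M" "emeasure M E < \<infinity>"
    and large: "\<And>x. x \<in> E \<Longrightarrow> \<exists>n. c * n < (\<Sum>k<n. f ((T ^^ k) x))"
  shows "c * measure M E \<le> (\<integral>x. f x \<partial>M)"
proof -
  have fm [measurable]: "f \<in> borel_measurable M" using f by auto
  define g where "g = (\<lambda>x. f x - c * indicator E x)"
  have g: "integrable M g"
    unfolding g_def using f E by (intro Bochner_Integration.integrable_diff integrable_mult_right integrable_real_indicator) auto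
  have fP: "integrable M (\<lambda>x. indicator A x * f x)" if "A \<in> sets M" for A
    using integrable_real_mult_indicator[OF that f(1)] by (simp add: mult.commute)
  define P where "P n = {x \<in> space M. 0 < max_orbit_sum g T n x}" for n
  have [measurable]: "max_orbit_sum g T n \<in> borel_measurable M" for n
    using integrable_max_orbit_sum[OF g] by auto
  have [measurable]: "P n \<in> sets M" for n unfolding P_def by measurable
  have "E \<subseteq> (\<Union>n. P n)"
  proof
    fix x assume x: "x \<in> E"
    then obtain n where n: "c * n < (\<Sum>k<n. f ((T ^^ k) x))" using large by auto
    have "(\<Sum>k<n. c * indicator E ((T ^^ k) x)) \<le> (\<Sum>k<n. c)"
      using \<open>0 < c\<close> by (intro sum_mono) (auto simp: indicator_def)
    then have "(\<Sum>k<n. f ((T ^^ k) x)) - c * n \<le> (\<Sum>k<n. g ((T ^^ k) x))"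
      unfolding g_def by (simp add: sum_subtractf mult.commute)
    then have "0 < max_orbit_sum g T n x"
      using n sum_orbit_le_max_orbit_sum[where f=g and T=T and n=n and x=x] by linarith
    then show "x \<in> (\<Union>n. P n)" using x sets.sets_into_space[OF E(1)] by (auto simp: P_def)
  qed
  then have E_eq: "E = (\<Union>n. E \<inter> P n)" by auto
  have bound: "measure M (E \<inter> P n) \<le> (\<integral>x. f x \<partial>M) / c" for n
  proof -
    have Efin: "emeasure M (E \<inter> P n) < \<infinity>"
      using E by (intro le_less_trans[OF emeasure_mono E(2)]) auto
    have "0 \<le> (\<integral>x. indicator {x. 0 < max_orbit_sum g T n x} x * g x \<partial>M)"
      by (rule maximal_ergodic_inequality[OF g])
    also have "\<dots> = (\<integral>x. indicator (P n) x * f x - c * indicator (E \<inter> P n) x \<partial>M)"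
      by (intro Bochner_Integration.integral_cong) (auto simp: P_def g_def indicator_def)
    also have "\<dots> = (\<integral>x. indicator (P n) x * f x \<partial>M) - c * measure M (E \<inter> P n)"
      using Efin f E by (subst Bochner_Integration.integral_diff)
        (auto intro!: fP simp del: indicator_simps)
    also have "(\<integral>x. indicator (P n) x * f x \<partial>M) \<le> (\<integral>x. f x \<partial>M)"
      using f by (intro integral_mono fP) (auto simp: indicator_def)
    finally show ?thesis using \<open>0 < c\<close> by (simp add: field_simps)
  qed
  have mono: "incseq (\<lambda>n. E \<inter> P n)"
  proof (rule incseq_SucI)
    fix n show "E \<inter> P n \<subseteq> E \<inter> P (Suc n)"
      using max_orbit_sum_mono_Suc[of g T n] unfolding P_def
      by (auto simp del: max_orbit_sum.simps dest: less_le_trans)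
  qed
  have "(\<lambda>n. measure M (E \<inter> P n)) \<longlonglongrightarrow> measure M (\<Union>n. E \<inter> P n)"
    using E E_eq mono by (intro Lim_measure_incseq) auto
  then have "measure M E \<le> (\<integral>x. f x \<partial>M) / c"
    using E_eq bound by (intro LIMSEQ_le_const2[of "\<lambda>n. measure M (E \<inter> P n)"]) auto
  then show ?thesis using \<open>0 < c\<close> by (simp add: field_simps)
qed

end

section \<open>Decay of correlations in infinite measure\<close>

locale infinite_ergodic = measure_preserving M T + sigma_finite_measure M
  for M :: "'w measure" and T +
  assumes ergodic: "ergodic_map M T"
    and infinite_measure: "emeasure M (space M) = \<infinity>"
begin

text \<open>The two averages differ by at most \<open>2 * b / n\<close>.\<close>

lemma limsup_average_T:
  assumes "\<And>x. \<bar>f x\<bar> \<le> (b::real)"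
  shows "limsup (\<lambda>n. ereal ((\<Sum>k<n. f ((T ^^ k) (T x))) / n)) = limsup (\<lambda>n. ereal ((\<Sum>k<n. f ((T ^^ k) x)) / n))"
proof -
  let ?v = "\<lambda>n. (f ((T ^^ n) x) - f x) / real n"
  have shift: "(\<Sum>k<n. f ((T ^^ k) (T x))) = (f ((T ^^ n) x) - f x) + (\<Sum>k<n. f ((T ^^ k) x))" for n
    using sum_orbit_Suc[of f T x n] by simp
  have "?v \<longlonglongrightarrow> 0"
  proof (rule Lim_null_comparison)
    show "\<forall>\<^sub>F n in sequentially. norm (?v n) \<le> 2 * b / real n"
    proof (intro always_eventually allI)
      fix n
      have "\<bar>f ((T ^^ n) x) - f x\<bar> \<le> 2 * b"
        using assms[of "(T ^^ n) x"] assms[of x] by linarith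
      then show "norm (?v n) \<le> 2 * b / real n"
        by (simp add: abs_divide divide_right_mono)
    qed
    show "(\<lambda>n. 2 * b / real n) \<longlonglongrightarrow> 0" by (rule lim_const_over_n)
  qed
  then have "(\<lambda>n. ereal (?v n)) \<longlonglongrightarrow> 0"
    using lim_ereal[of ?v 0 sequentially] by (simp add: zero_ereal_def)
  then have "limsup (\<lambda>n. ereal (?v n) + ereal ((\<Sum>k<n. f ((T ^^ k) x)) / n))
      = 0 + limsup (\<lambda>n. ereal ((\<Sum>k<n. f ((T ^^ k) x)) / n))"
    by (intro ereal_limsup_lim_add) auto
  then show ?thesis by (simp add: shift add_divide_distrib)
qed

text \<open>The set where the upper limit of the averages is at least \<open>c\<close> is invariant, hence null or conull. If it
were conull, it would contain sets of arbitrarily large finite measure, against the weak type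
inequality, which bounds their measure by \<open>2 * (\<integral> f) / c\<close>.\<close>

lemma average_tendsto_0:
  assumes f: "integrable M f" and nonneg: "\<And>x. 0 \<le> f x" and bound: "\<And>x. f x \<le> (b::real)"
  shows "AE x in M. (\<lambda>n. (\<Sum>k<n. f ((T ^^ k) x)) / n) \<longlonglongrightarrow> 0"
proof -
  define a where "a n x = (\<Sum>k<n. f ((T ^^ k) x)) / real n" for n x
  define U where "U c = {x \<in> space M. ereal c \<le> limsup (\<lambda>n. ereal (a n x))}" for c :: real
  have [measurable]: "f \<in> borel_measurable M" using f by auto
  have [measurable]: "a n \<in> borel_measurable M" for n unfolding a_def by measurable
  have U [measurable]: "U c \<in> sets M" for c unfolding U_def by measurable
  have null: "emeasure M (U c) = 0" if "0 < c" for c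
  proof (rule ccontr)
    assume pos: "emeasure M (U c) \<noteq> 0"
    have "T -` U c \<inter> space M = U c"
      using limsup_average_T[of f b] nonneg bound measurable_space[OF measurable_T]
      unfolding U_def a_def by auto
    then have "emeasure M (space M - U c) = 0"
      using ergodic U pos unfolding ergodic_map_def by blast
    then have "emeasure M (U c) = \<infinity>"
      using infinite_measure emeasure_Diff_null_set[of "space M - U c" M "space M"] U
      by (simp add: null_sets_def Diff_Diff_Int Int_absorb1 sets.sets_into_space)
    then obtain E where E: "E \<in> sets M" "E \<subseteq> U c" "emeasure M E < \<infinity>"
      and big: "ennreal (2 * (\<integral>x. f x \<partial>M) / c) < emeasure M E"
      using approx_PInf_emeasure_with_finite[OF U, of c "2 * (\<integral>x. f x \<partial>M) / c"] by auto
    have "c / 2 * measure M E \<le> (\<integral>x. f x \<partial>M)"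
    proof (rule maximal_inequality_weak_type[OF f nonneg _ E(1) E(3)])
      fix x assume "x \<in> E"
      then have x: "ereal c \<le> limsup (\<lambda>n. ereal (a n x))" using E by (auto simp: U_def)
      show "\<exists>n. c / 2 * real n < (\<Sum>k<n. f ((T ^^ k) x))"
      proof (rule ccontr)
        assume "\<not> ?thesis"
        then have "a n x \<le> c / 2" for n
          using \<open>0 < c\<close> by (cases "n = 0") (auto simp: a_def not_less field_simps)
        then have "limsup (\<lambda>n. ereal (a n x)) \<le> ereal (c / 2)"
          by (intro Limsup_bounded always_eventually) auto
        with x have "ereal c \<le> ereal (c / 2)" by (rule order_trans)
        then show False using \<open>0 < c\<close> by simp
      qed
    qed (use \<open>0 < c\<close> in auto)
    moreover have "2 * (\<integral>x. f x \<partial>M) / c < measure M E"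
      using big E \<open>0 < c\<close> nonneg
      by (simp add: emeasure_eq_ennreal_measure ennreal_less_iff integral_nonneg_AE)
    ultimately show False using \<open>0 < c\<close> by (simp add: field_simps)
  qed
  have "AE x in M. \<forall>m. x \<notin> U (1 / Suc m)"
    by (intro AE_all_countable[THEN iffD2] allI AE_not_in) (simp add: null null_sets_def)
  then show ?thesis
  proof (rule AE_mp, intro AE_I2 impI)
    fix x assume x: "x \<in> space M" "\<forall>m. x \<notin> U (1 / Suc m)"
    have "(\<lambda>n. a n x) \<longlonglongrightarrow> 0"
    proof (rule order_tendstoI)
      fix e :: real assume "0 < e"
      then obtain m where m: "1 / Suc m < e" using nat_approx_posE by blast
      have "limsup (\<lambda>n. ereal (a n x)) < ereal (1 / Suc m)"
        using x by (auto simp: U_def not_le)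
      then have "\<forall>\<^sub>F n in sequentially. ereal (a n x) < ereal (1 / Suc m)"
        by (rule Limsup_lessD)
      then show "\<forall>\<^sub>F n in sequentially. a n x < e"
        by eventually_elim (use m in auto)
    next
      fix e :: real assume "e < 0"
      moreover have "0 \<le> a n x" for n unfolding a_def by (simp add: sum_nonneg nonneg)
      ultimately show "\<forall>\<^sub>F n in sequentially. e < a n x"
        by (intro always_eventually allI) (meson less_le_trans)
    qed
    then show "(\<lambda>n. (\<Sum>k<n. f ((T ^^ k) x)) / n) \<longlonglongrightarrow> 0" unfolding a_def .
  qed
qed

lemma integrable_correlation:
  assumes f: "integrable M f" and "\<And>x. 0 \<le> f x" "\<And>x. f x \<le> (b::real)"
  shows "integrable M (\<lambda>x. f x * f ((T ^^ k) x))"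
proof (rule Bochner_Integration.integrable_bound)
  show "integrable M (\<lambda>x. b * f x)" using f by simp
  have [measurable]: "f \<in> borel_measurable M" using f by auto
  show "(\<lambda>x. f x * f ((T ^^ k) x)) \<in> borel_measurable M" by measurable
  show "AE x in M. norm (f x * f ((T ^^ k) x)) \<le> norm (b * f x)"
  proof (rule AE_I2)
    fix x
    have "f ((T ^^ k) x) * f x \<le> b * f x" by (intro mult_right_mono assms)
    moreover have "0 \<le> b" using assms(2,3) order_trans by blast
    ultimately show "norm (f x * f ((T ^^ k) x)) \<le> norm (b * f x)"
      using assms(2) by (simp add: abs_mult mult.commute)
  qed
qed

text \<open>By dominated convergence the averages of the correlations tend to \<open>0\<close>, so the correlations are not
bounded away from \<open>0\<close>.\<close>

lemma correlation_small:
  assumes f: "integrable M f" and nonneg: "\<And>x. 0 \<le> f x" and bound: "\<And>x. f x \<le> (b::real)"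
    and "0 < e"
  shows "\<exists>n\<ge>N. (\<integral>x. f x * f ((T ^^ n) x) \<partial>M) < e"
proof (rule ccontr)
  assume contra: "\<not> ?thesis"
  define c where "c k = (\<integral>x. f x * f ((T ^^ k) x) \<partial>M)" for k
  have large: "e \<le> c n" if "N \<le> n" for n using contra that by (auto simp: c_def not_less)
  have c0: "0 \<le> c k" for k unfolding c_def by (intro integral_nonneg_AE) (simp add: nonneg)
  have b0: "0 \<le> b" using nonneg[of undefined] bound[of undefined] by simp
  have [measurable]: "f \<in> borel_measurable M" using f by auto
  have "(\<lambda>n. \<integral>x. f x * ((\<Sum>k<n. f ((T ^^ k) x)) / n) \<partial>M) \<longlonglongrightarrow> (\<integral>x. 0 \<partial>M)"
  proof (rule integral_dominated_convergence[where w="\<lambda>x. b * f x"])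
    show "integrable M (\<lambda>x. b * f x)" using f by simp
    show "AE x in M. (\<lambda>n. f x * ((\<Sum>k<n. f ((T ^^ k) x)) / n)) \<longlonglongrightarrow> 0"
      using average_tendsto_0[OF f nonneg bound]
      by eventually_elim (intro tendsto_mult_right_zero)
    fix n
    show "AE x in M. norm (f x * ((\<Sum>k<n. f ((T ^^ k) x)) / n)) \<le> b * f x"
    proof (rule AE_I2)
      fix x
      have "(\<Sum>k<n. f ((T ^^ k) x)) \<le> (\<Sum>k<n. b)" by (intro sum_mono bound)
      then have "(\<Sum>k<n. f ((T ^^ k) x)) / n \<le> b"
        using b0 by (cases "n = 0") (auto simp: field_simps)
      then have "f x * ((\<Sum>k<n. f ((T ^^ k) x)) / n) \<le> f x * b"
        by (intro mult_left_mono nonneg)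
      then show "norm (f x * ((\<Sum>k<n. f ((T ^^ k) x)) / n)) \<le> b * f x"
        using nonneg by (simp add: abs_mult sum_nonneg mult.commute)
    qed
  qed auto
  also have "(\<lambda>n. \<integral>x. f x * ((\<Sum>k<n. f ((T ^^ k) x)) / n) \<partial>M) = (\<lambda>n. (\<Sum>k<n. c k) / n)"
  proof
    fix n
    have "(\<integral>x. f x * ((\<Sum>k<n. f ((T ^^ k) x)) / n) \<partial>M) = (\<integral>x. (\<Sum>k<n. f x * f ((T ^^ k) x)) / n \<partial>M)"
      by (simp add: sum_distrib_left)
    also have "\<dots> = (\<Sum>k<n. c k) / n"
      unfolding c_def using integrable_correlation[OF f nonneg bound]
      by (simp add: Bochner_Integration.integral_sum)
    finally show "(\<integral>x. f x * ((\<Sum>k<n. f ((T ^^ k) x)) / n) \<partial>M) = (\<Sum>k<n. c k) / n" .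
  qed
  finally have "(\<lambda>n. (\<Sum>k<n. c k) / n) \<longlonglongrightarrow> 0" by simp
  then have "\<forall>\<^sub>F n in sequentially. (\<Sum>k<n. c k) / n < e / 2"
    using \<open>0 < e\<close> by (intro order_tendstoD) auto
  then obtain n0 where n0: "\<And>n. n0 \<le> n \<Longrightarrow> (\<Sum>k<n. c k) / n < e / 2"
    unfolding eventually_sequentially by auto
  \<comment> \<open>at least half of the first \<open>n\<close> correlations have index \<open>\<ge> N\<close>, so that the average is at least \<open>e / 2\<close>\<close>
  define n where "n = max n0 (2 * N + 1)"
  have "(\<Sum>k\<in>{N..<n}. e) \<le> (\<Sum>k\<in>{N..<n}. c k)" by (intro sum_mono large) auto
  also have "\<dots> \<le> (\<Sum>k<n. c k)" by (intro sum_mono2 c0) auto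
  also have "\<dots> < e / 2 * n" using n0[of n] unfolding n_def by (simp add: field_simps)
  finally have "real (n - N) < real n / 2" using \<open>0 < e\<close> by simp
  moreover have "2 * N < n" unfolding n_def by simp
  ultimately show False by linarith
qed

end

lemma (in sigma_finite_measure) obtain_positive_integrable:
  obtains g :: "'a \<Rightarrow> real"
  where "integrable M g" "\<And>x. x \<in> space M \<Longrightarrow> 0 < g x" "\<And>x. 0 \<le> g x" "\<And>x. g x \<le> 1"
proof -
  obtain h where h: "h \<in> borel_measurable M" "integral\<^sup>N M h \<noteq> \<infinity>"
      "\<And>x. x \<in> space M \<Longrightarrow> 0 < h x \<and> h x < \<infinity>"
    using Ex_finite_integrable_function by metis
  define g where "g x = min 1 (enn2real (h x))" for x
  have [measurable]: "g \<in> borel_measurable M" using h unfolding g_def by measurable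
  have "(\<integral>\<^sup>+x. ennreal (g x) \<partial>M) \<le> integral\<^sup>N M h"
    unfolding g_def using h(3)
    by (intro nn_integral_mono) (metis enn2real_nonneg ennreal_enn2real_if ennreal_leI infinity_ennreal_def min.cobounded2 top.not_eq_extremum)
  then have "integrable M g"
    using h(2) by (intro integrableI_bounded) (auto simp: g_def top.not_eq_extremum[symmetric] top_unique)
  moreover have "0 < g x" if "x \<in> space M" for x
    using h(3)[OF that] by (auto simp: g_def enn2real_positive_iff)
  ultimately show ?thesis using that[of g] by (auto simp: g_def)
qed

context infinite_ergodic
begin

text \<open>On the set of points of period \<open>p\<close> there is a positive integrable function invariant under \<open>T\<close>: sum a
positive integrable function over the period. Its correlations are constant, hence \<open>0\<close>.\<close>

lemma periodic_null:
  assumes "0 < p" and [measurable]: "{x \<in> space M. (T ^^ p) x = x} \<in> sets M"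
  shows "AE x in M. (T ^^ p) x \<noteq> x"
proof -
  obtain g :: "'w \<Rightarrow> real" where g: "integrable M g" "\<And>x. x \<in> space M \<Longrightarrow> 0 < g x"
      "\<And>x. 0 \<le> g x" "\<And>x. g x \<le> 1"
    using obtain_positive_integrable by blast
  have [measurable]: "g \<in> borel_measurable M" using g by auto
  define Per where "Per = {x \<in> space M. (T ^^ p) x = x}"
  \<comment> \<open>positive on \<open>Per\<close>, invariant there under \<open>T\<close>, and bounded by \<open>p\<close>\<close>
  define f where "f x = (\<Sum>s<p. g ((T ^^ s) x)) * indicator Per x" for x
  have Per_T: "T x \<in> Per" if "x \<in> Per" for x
    using that measurable_space[OF measurable_T] by (auto simp: Per_def funpow_swap1[symmetric])
  have f_T: "f (T x) = f x" if "x \<in> Per" for x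
  proof -
    have "g x + (\<Sum>s<p. g ((T ^^ s) (T x))) = (\<Sum>s<p. g ((T ^^ s) x)) + g ((T ^^ p) x)"
      using sum_orbit_Suc[of g T x p] by simp
    then show ?thesis using that Per_T[OF that] by (simp add: f_def Per_def)
  qed
  have f_funpow: "f ((T ^^ n) x) = f x" if "x \<in> Per" for n x
  proof -
    have "(T ^^ n) x \<in> Per \<and> f ((T ^^ n) x) = f x"
      by (induction n) (use that f_T Per_T in auto)
    then show ?thesis by simp
  qed
  have f_int: "integrable M f"
    unfolding f_def Per_def
    by (intro integrable_real_mult_indicator Bochner_Integration.integrable_sum integrable_funpow g(1))
       measurable
  have f0: "0 \<le> f x" for x unfolding f_def by (simp add: sum_nonneg g)
  have fb: "f x \<le> real p" for x
  proof -
    have "(\<Sum>s<p. g ((T ^^ s) x)) \<le> (\<Sum>s<p. 1)" by (intro sum_mono g)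
    then show ?thesis by (auto simp: f_def indicator_def)
  qed
  have "(\<integral>x. f x * f x \<partial>M) = 0"
  proof (rule antisym[OF field_le_epsilon])
    fix e :: real assume "0 < e"
    then obtain n where "(\<integral>x. f x * f ((T ^^ n) x) \<partial>M) < e"
      using correlation_small[OF f_int f0 fb, of e 0] by auto
    moreover have "f x * f ((T ^^ n) x) = f x * f x" for x
      using f_funpow[of x n] by (cases "x \<in> Per") (auto simp: f_def)
    ultimately show "(\<integral>x. f x * f x \<partial>M) \<le> 0 + e" by simp
  qed (simp add: f0)
  then have "AE x in M. f x * f x = 0"
    using integrable_correlation[OF f_int f0 fb, of 0]
    by (subst (asm) integral_nonneg_eq_0_iff_AE) (auto simp: f0)
  then show ?thesis
  proof (rule AE_mp, intro AE_I2 impI notI)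
    fix x assume x: "x \<in> space M" "f x * f x = 0" "(T ^^ p) x = x"
    have "0 < (\<Sum>s<p. g ((T ^^ s) x))"
      using \<open>0 < p\<close> measurable_space[OF measurable_funpow x(1)] by (intro sum_pos g) auto
    then show False using x by (auto simp: f_def Per_def)
  qed
qed

end

section \<open>Integer iterates and aperiodic points\<close>

lemma int_iterate_0 [simp]: "int_iterate T 0 = id"
  by (simp add: int_iterate_def id_def)

lemma int_iterate_of_nat: "int_iterate T (int n) = T ^^ n"
  by (simp add: int_iterate_def)

lemma int_iterate_succ:
  assumes "bij T"
  shows "int_iterate T (k + 1) x = T (int_iterate T k x)"
proof (cases "0 \<le> k")
  case True
  then show ?thesis by (simp add: int_iterate_def nat_add_distrib)
next
  case False
  define m where "m = nat (- (k + 1))"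
  have k: "nat (- k) = Suc m" "k + 1 = - int m" using False by (auto simp: m_def)
  have "int_iterate T (k + 1) x = (inv T ^^ m) x"
    using k by (cases "m = 0") (auto simp: int_iterate_def)
  moreover have "T (int_iterate T k x) = (inv T ^^ m) x"
    using k False assms by (simp add: int_iterate_def bij_is_surj surj_f_inv_f)
  ultimately show ?thesis by simp
qed

lemma int_iterate_pred:
  assumes "bij T"
  shows "int_iterate T (k - 1) x = inv T (int_iterate T k x)"
  using int_iterate_succ[OF assms, of "k - 1" x] assms by (simp add: bij_is_inj)

lemma int_iterate_add:
  assumes "bij T"
  shows "int_iterate T (a + b) x = int_iterate T a (int_iterate T b x)"
proof (induction a rule: int_induct[where k=0])
  case (step1 i)
  then show ?case using int_iterate_succ[OF assms, of "i + b" x] int_iterate_succ[OF assms, of i]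
    by (simp add: algebra_simps)
next
  case (step2 i)
  then show ?case using int_iterate_pred[OF assms, of "i + b" x] int_iterate_pred[OF assms, of i]
    by (simp add: algebra_simps)
qed simp

lemma int_iterate_T:
  assumes "bij T"
  shows "int_iterate T k (T x) = T (int_iterate T k x)"
  using int_iterate_add[OF assms, of k 1 x] int_iterate_succ[OF assms, of k x]
  by (simp add: int_iterate_def)

lemma int_iterate_minus_cancel:
  assumes "bij T"
  shows "int_iterate T (- k) (int_iterate T k x) = x"
  using int_iterate_add[OF assms, of "- k" k x] by simp

text \<open>Stated with integer iterates, since clusters extend in both directions of an orbit.\<close>

definition aperiodic :: "('a \<Rightarrow> 'a) \<Rightarrow> 'a \<Rightarrow> bool" where
  "aperiodic T x \<longleftrightarrow> inj (\<lambda>k::int. int_iterate T k x)"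

lemma aperiodic_iff:
  assumes "bij T"
  shows "aperiodic T x \<longleftrightarrow> (\<forall>p>0. (T ^^ p) x \<noteq> x)"
proof
  assume *: "aperiodic T x"
  show "\<forall>p>0. (T ^^ p) x \<noteq> x"
  proof (intro allI impI notI)
    fix p :: nat assume "0 < p" "(T ^^ p) x = x"
    then show False
      using injD[OF *[unfolded aperiodic_def], of "int p" 0] by (simp add: int_iterate_of_nat)
  qed
next
  assume *: "\<forall>p>0. (T ^^ p) x \<noteq> x"
  have neq: "int_iterate T k x \<noteq> int_iterate T l x" if "k < l" for k l
  proof
    assume "int_iterate T k x = int_iterate T l x"
    then have "int_iterate T (- k + k) x = int_iterate T (- k + l) x"
      unfolding int_iterate_add[OF assms] by simp
    then have "(T ^^ nat (l - k)) x = x"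
      using that by (simp add: int_iterate_def)
    then show False using * that by simp
  qed
  show "aperiodic T x"
    unfolding aperiodic_def by (intro injI) (metis neq linorder_neq_iff)
qed

locale infinite_system =
  fixes \<mu> :: "'a::polish_space measure" and T :: "'a \<Rightarrow> 'a"
  assumes sets_\<mu> [measurable_cong]: "sets \<mu> = sets borel"
    and boundedly_finite: "boundedly_finite \<mu>"
    and invertible: "invertible_mpt \<mu> T"
    and ergodic: "ergodic_map \<mu> T"
    and conservative: "conservative_map \<mu> T"
    and infinite: "emeasure \<mu> UNIV = \<infinity>"
begin

lemma space_\<mu> [simp]: "space \<mu> = UNIV"
  using sets_eq_imp_space_eq[OF sets_\<mu>] by simp

lemma bij_T: "bij T" and measurable_T_borel: "T \<in> borel \<rightarrow>\<^sub>M borel"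
  and measurable_inv_T: "inv T \<in> borel \<rightarrow>\<^sub>M borel"
  using invertible by (simp_all add: invertible_mpt_def cong: measurable_cong_sets[OF sets_\<mu> sets_\<mu>])

lemma sigma_finite: "sigma_finite_measure \<mu>"
proof
  let ?A = "range (\<lambda>n::nat. ball (undefined :: 'a) n)"
  have "\<Union> ?A = UNIV" using real_arch_simple by (auto intro: less_imp_le) (meson reals_Archimedean2)
  then show "\<exists>A. countable A \<and> A \<subseteq> sets \<mu> \<and> \<Union> A = space \<mu> \<and> (\<forall>a\<in>A. emeasure \<mu> a \<noteq> \<infinity>)"
    using boundedly_finite by (intro exI[of _ ?A]) (auto simp: boundedly_finite_def sets_\<mu> less_top)
qed

sublocale infinite_ergodic \<mu> T
proof -
  interpret sigma_finite_measure \<mu> by (rule sigma_finite)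
  show "infinite_ergodic \<mu> T"
    by unfold_locales
       (use invertible ergodic infinite in \<open>auto simp: invertible_mpt_def\<close>)
qed

abbreviation iter :: "int \<Rightarrow> 'a \<Rightarrow> 'a" where
  "iter \<equiv> int_iterate T"

lemma measurable_iter [measurable]: "iter k \<in> borel \<rightarrow>\<^sub>M borel"
proof -
  have pow: "f ^^ n \<in> borel \<rightarrow>\<^sub>M borel" if [measurable]: "f \<in> borel \<rightarrow>\<^sub>M borel" for f :: "'a \<Rightarrow> 'a" and n
    by (induction n) (simp_all add: id_def)
  show ?thesis
    unfolding int_iterate_def using pow[OF measurable_T_borel] pow[OF measurable_inv_T] by simp
qed

lemma nn_integral_iter:
  assumes [measurable]: "g \<in> borel_measurable borel"
  shows "(\<integral>\<^sup>+x. g (iter k x) \<partial>\<mu>) = (\<integral>\<^sup>+x. g x \<partial>\<mu>)"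
proof (cases "0 \<le> k")
  case True
  then show ?thesis using nn_integral_funpow[of g "nat k"] by (simp add: int_iterate_def)
next
  case False
  have "(\<integral>\<^sup>+x. g (iter k x) \<partial>\<mu>) = (\<integral>\<^sup>+x. g (iter k ((T ^^ nat (- k)) x)) \<partial>\<mu>)"
    using nn_integral_funpow[of "\<lambda>x. g (iter k x)" "nat (- k)"] by simp
  also have "(T ^^ nat (- k)) x = iter (- k) x" for x
    using False by (simp add: int_iterate_def)
  then have "(\<integral>\<^sup>+x. g (iter k ((T ^^ nat (- k)) x)) \<partial>\<mu>) = (\<integral>\<^sup>+x. g x \<partial>\<mu>)"
    using int_iterate_minus_cancel[OF bij_T, of "- k"] by simp
  finally show ?thesis .
qed

lemma measurable_aperiodic [measurable]: "Measurable.pred borel (aperiodic T)"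
proof -
  have [measurable]: "T ^^ n \<in> borel \<rightarrow>\<^sub>M borel" for n
    using measurable_iter[of "int n"] by (simp add: int_iterate_of_nat)
  show ?thesis unfolding aperiodic_iff[OF bij_T, abs_def] by measurable
qed

lemma AE_aperiodic: "AE x in \<mu>. aperiodic T x"
proof -
  have [measurable]: "T ^^ n \<in> borel \<rightarrow>\<^sub>M borel" for n
    using measurable_iter[of "int n"] by (simp add: int_iterate_of_nat)
  have "AE x in \<mu>. 0 < p \<longrightarrow> (T ^^ p) x \<noteq> x" for p
    using periodic_null[of p] by (cases "0 < p") simp_all
  then show ?thesis unfolding aperiodic_iff[OF bij_T] by (simp add: AE_all_countable)
qed

text \<open>An atom is not a wandering set, so its orbit returns to it and it is a periodic point.\<close>

lemma emeasure_singleton: "emeasure \<mu> {x} = 0"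
proof (rule ccontr)
  assume pos: "emeasure \<mu> {x} \<noteq> 0"
  then have "\<not> wandering_set \<mu> T {x}" using conservative unfolding conservative_map_def by blast
  then obtain m n y where "m \<noteq> n" "(T ^^ m) y = x" "(T ^^ n) y = x"
    unfolding wandering_set_def disjoint_family_on_def by (auto simp: sets_\<mu>)
  then have y: "iter (int m) y = x" "iter (int n) y = x" by (simp_all add: int_iterate_of_nat)
  have "\<not> aperiodic T x"
  proof
    assume "aperiodic T x"
    moreover have "iter (int n - int m) x = iter 0 x"
      using int_iterate_add[OF bij_T, of "int n - int m" "int m" y] y by simp
    ultimately have "int n - int m = 0" unfolding aperiodic_def by (rule injD)
    then show False using \<open>m \<noteq> n\<close> by simp
  qed
  then have "emeasure \<mu> {x} \<le> emeasure \<mu> {x \<in> space \<mu>. \<not> aperiodic T x}"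
    by (intro emeasure_mono) auto
  also have "\<dots> = 0" using AE_aperiodic by (simp add: AE_iff_measurable[OF _ refl])
  finally show False using pos by simp
qed

end

section \<open>Coin sequences and the displacement cocycle\<close>

definition coin :: "(nat \<Rightarrow> bool) measure" where
  "coin = PiM UNIV (\<lambda>_. measure_pmf (bernoulli_pmf (1 / 2)))"

definition flip :: "nat set \<Rightarrow> (nat \<Rightarrow> bool) \<Rightarrow> nat \<Rightarrow> bool" where
  "flip F \<epsilon> = (\<lambda>i. \<epsilon> i \<noteq> (i \<in> F))"

text \<open>The flip of coin \<open>i\<close> from \<open>False\<close> to \<open>True\<close> contributes \<open>n i\<close>, and the flip back contributes \<open>- n i\<close>. Hence
the displacement is the change of the formal sum of all \<open>n i\<close> with \<open>\<epsilon> i = True\<close>; this sum may be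
infinite, but finite flips change it by a finite amount.\<close>

definition displacement :: "(nat \<Rightarrow> nat) \<Rightarrow> nat set \<Rightarrow> (nat \<Rightarrow> bool) \<Rightarrow> int" where
  "displacement n F \<epsilon> = (\<Sum>i\<in>F. if \<epsilon> i then - int (n i) else int (n i))"

lemma prob_space_coin: "prob_space coin"
  unfolding coin_def by (intro prob_space_PiM prob_space_measure_pmf)

lemma space_coin [simp]: "space coin = UNIV"
  by (simp add: coin_def space_PiM PiE_def extensional_def)

lemma measurable_coin_component [measurable]: "(\<lambda>\<epsilon>. \<epsilon> i) \<in> coin \<rightarrow>\<^sub>M count_space UNIV"
proof -
  have "(\<lambda>\<epsilon>. \<epsilon> i) \<in> PiM UNIV (\<lambda>_. measure_pmf (bernoulli_pmf (1 / 2))) \<rightarrow>\<^sub>M measure_pmf (bernoulli_pmf (1 / 2))"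
    by (rule measurable_component_singleton) simp
  then show ?thesis unfolding coin_def by (simp cong: measurable_cong_sets)
qed

lemma measurable_flip [measurable]: "flip F \<in> coin \<rightarrow>\<^sub>M coin"
proof -
  have "(\<lambda>\<epsilon>. \<lambda>i. \<epsilon> i \<noteq> (i \<in> F)) \<in> coin \<rightarrow>\<^sub>M PiM UNIV (\<lambda>_. measure_pmf (bernoulli_pmf (1 / 2)))"
  proof (rule measurable_PiM_single')
    show "(\<lambda>\<epsilon>. \<epsilon> i \<noteq> (i \<in> F)) \<in> coin \<rightarrow>\<^sub>M measure_pmf (bernoulli_pmf (1 / 2))" for i
      by (subst measurable_cong_sets[OF refl, of _ "count_space UNIV"]) simp_all
  qed (simp add: PiE_def extensional_def)
  then show ?thesis unfolding flip_def coin_def .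
qed

lemma distr_flip: "distr coin coin (flip F) = coin"
proof -
  let ?p = "measure_pmf (bernoulli_pmf (1 / 2))"
  interpret product_prob_space "\<lambda>_::nat. ?p" UNIV
    by unfold_locales
  have half: "measure_pmf.prob (bernoulli_pmf (1 / 2)) {b. (b \<noteq> c) \<in> X} = measure_pmf.prob (bernoulli_pmf (1 / 2)) X" for c X
  proof -
    have "map_pmf (\<lambda>b. b \<noteq> c) (bernoulli_pmf (1 / 2)) = bernoulli_pmf (1 / 2)"
    proof (rule pmf_eqI)
      fix b
      have "pmf (map_pmf (\<lambda>b. b \<noteq> c) (bernoulli_pmf (1 / 2))) (b \<noteq> c) = pmf (bernoulli_pmf (1 / 2)) b" for b
        by (intro pmf_map_inj') (auto intro!: injI)
      from this[of "b \<noteq> c"] show "pmf (map_pmf (\<lambda>b. b \<noteq> c) (bernoulli_pmf (1 / 2))) b = pmf (bernoulli_pmf (1 / 2)) b"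
        by (cases b; cases c) auto
    qed
    then have "measure_pmf.prob (bernoulli_pmf (1 / 2)) X = measure_pmf.prob (map_pmf (\<lambda>b. b \<noteq> c) (bernoulli_pmf (1 / 2))) X"
      by simp
    also have "\<dots> = measure_pmf.prob (bernoulli_pmf (1 / 2)) ((\<lambda>b. b \<noteq> c) -` X)" by (rule measure_map_pmf)
    finally show ?thesis by (simp add: vimage_def)
  qed
  have "distr coin coin (flip F) = PiM UNIV (\<lambda>_. ?p)"
  proof (rule PiM_eq)
    show "sets (distr coin coin (flip F)) = sets (PiM UNIV (\<lambda>_. ?p))" by (simp add: coin_def)
    fix J :: "nat set" and A :: "nat \<Rightarrow> bool set"
    assume J: "finite J" "J \<subseteq> UNIV" "\<And>i. i \<in> J \<Longrightarrow> A i \<in> sets ?p"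
    have "emeasure (distr coin coin (flip F)) (prod_emb UNIV (\<lambda>_. ?p) J (Pi\<^sub>E J A))
      = emeasure coin (flip F -` prod_emb UNIV (\<lambda>_. ?p) J (Pi\<^sub>E J A) \<inter> space coin)"
      using J by (intro emeasure_distr measurable_flip) (auto simp: coin_def intro!: sets_PiM_I)
    also have "flip F -` prod_emb UNIV (\<lambda>_. ?p) J (Pi\<^sub>E J A) \<inter> space coin
      = prod_emb UNIV (\<lambda>_. ?p) J (\<Pi>\<^sub>E i\<in>J. {b. (b \<noteq> (i \<in> F)) \<in> A i})"
      by (auto simp: prod_emb_def flip_def PiE_def Pi_def extensional_def restrict_def space_PiM)
    also have "emeasure coin \<dots> = (\<Prod>i\<in>J. emeasure ?p (A i))"
      unfolding coin_def using J
      by (subst emeasure_PiM_emb) (auto simp: measure_pmf.emeasure_eq_measure half[simplified])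
    finally show "emeasure (distr coin coin (flip F)) (prod_emb UNIV (\<lambda>_. ?p) J (Pi\<^sub>E J A))
      = (\<Prod>i\<in>J. emeasure ?p (A i))" .
  qed
  then show ?thesis unfolding coin_def by simp
qed

lemma nn_integral_flip:
  assumes [measurable]: "h \<in> borel_measurable coin"
  shows "(\<integral>\<^sup>+\<epsilon>. h (flip F \<epsilon>) \<partial>coin) = (\<integral>\<^sup>+\<epsilon>. h \<epsilon> \<partial>coin)"
  by (subst (2) distr_flip[of F, symmetric]) (simp add: nn_integral_distr)

lemma measurable_displacement [measurable]: "displacement n F \<in> coin \<rightarrow>\<^sub>M count_space UNIV"
proof (induction F rule: infinite_finite_induct)
  case (insert i F)
  have "(\<lambda>\<epsilon>. j + displacement n F \<epsilon>) \<in> coin \<rightarrow>\<^sub>M count_space UNIV" for j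
    using insert.IH by (rule measurable_compose) simp
  then have "(\<lambda>\<epsilon>. (if \<epsilon> i then - int (n i) else int (n i)) + displacement n F \<epsilon>) \<in> coin \<rightarrow>\<^sub>M count_space UNIV"
    by (rule measurable_compose_countable) measurable
  then show ?case using insert.hyps by (simp add: displacement_def)
qed (simp_all add: displacement_def)

lemma flip_flip: "flip F (flip G \<epsilon>) = flip (sym_diff F G) \<epsilon>"
  by (auto simp: flip_def)

text \<open>A coin in both sets is flipped twice, and its two contributions cancel.\<close>

lemma displacement_cocycle:
  assumes "finite F" "finite G"
  shows "displacement n (sym_diff F G) \<epsilon> = displacement n G \<epsilon> + displacement n F (flip G \<epsilon>)"
proof -
  \<comment> \<open>the three sums are written over the common index set \<open>F \<union> G\<close>\<close>
  have extend: "displacement n A \<delta> = (\<Sum>i\<in>F \<union> G. if i \<in> A then (if \<delta> i then - int (n i) else int (n i)) else 0)"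
    if "A \<subseteq> F \<union> G" for A \<delta>
    using that assms unfolding displacement_def by (subst sum.inter_restrict[symmetric]) (auto simp: Int_absorb1)
  show ?thesis
    unfolding extend[of G, OF Un_upper2] extend[of F, OF Un_upper1] sum.distrib[symmetric]
    by (subst extend) (auto intro!: sum.cong simp: flip_def)
qed

lemma abs_displacement_le:
  assumes "finite F" "F \<subseteq> {..<i}"
  shows "\<bar>displacement n F \<epsilon>\<bar> \<le> (\<Sum>l<i. int (n l))"
proof -
  have "\<bar>displacement n F \<epsilon>\<bar> \<le> (\<Sum>l\<in>F. int (n l))"
    unfolding displacement_def by (rule order_trans[OF sum_abs]) (auto intro!: sum_mono)
  also have "\<dots> \<le> (\<Sum>l<i. int (n l))" using assms by (intro sum_mono2) auto
  finally show ?thesis .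
qed

text \<open>There are \<open>2\<^sup>i\<close> sets with maximum \<open>i\<close>, so the sum is dominated by a geometric series. In the enumeration of
finite sets by binary expansion, \<open>k < 2 * 2 ^ Max F\<close> for the code \<open>k\<close> of \<open>F\<close>, and the comparison series is that of \<open>4 / k\<^sup>2\<close>.\<close>

lemma finite_sum_over_finite_sets:
  "(\<integral>\<^sup>+F. (if F = {} then c else ennreal ((1 / 4) ^ Max F)) \<partial>count_space {F :: nat set. finite F}) \<noteq> \<infinity>"
  if "c \<noteq> \<infinity>"
proof -
  let ?\<beta> = "\<lambda>F. if F = {} then c else ennreal ((1 / 4) ^ Max F)"
  have bij: "bij_betw set_decode UNIV {F :: nat set. finite F}"
    by (rule bij_betwI[of _ _ _ set_encode]) auto
  have le: "?\<beta> (set_decode k) \<le> (if k = 0 then c else 0) + ennreal (4 * inverse (real k ^ 2))" for k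
  proof (cases "k = 0")
    case False
    let ?F = "set_decode k"
    have ne: "?F \<noteq> {}" using False by (metis set_decode_inverse set_encode_empty)
    have "k = (\<Sum>j\<in>?F. 2 ^ j)" using set_decode_inverse[of k] by (simp add: set_encode_def)
    also have "\<dots> \<le> (\<Sum>j<Suc (Max ?F). 2 ^ j)"
      by (intro sum_mono2) (auto simp: less_Suc_eq_le)
    also have "\<dots> \<le> 2 * 2 ^ Max ?F" using sum_power2[of "Suc (Max ?F)"] by (simp add: atLeast0LessThan del: sum.lessThan_Suc)
    finally have "real k \<le> 2 * 2 ^ Max ?F" by (metis of_nat_le_iff of_nat_mult of_nat_numeral of_nat_power)
    then have "real k ^ 2 \<le> (2 * 2 ^ Max ?F) ^ 2" by (intro power_mono) auto
    also have "\<dots> = 4 * 4 ^ Max ?F" by (simp add: power_mult_distrib power2_eq_square flip: power_mult_distrib)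
    finally have "(1 / 4) ^ Max ?F \<le> 4 * inverse (real k ^ 2)"
      using False by (simp add: field_simps power_one_over)
    then show ?thesis using False ne by (simp add: ennreal_leI)
  qed (simp add: that)
  have "(\<integral>\<^sup>+F. ?\<beta> F \<partial>count_space {F :: nat set. finite F}) = (\<integral>\<^sup>+k. ?\<beta> (set_decode k) \<partial>count_space UNIV)"
    by (rule nn_integral_bij_count_space[OF bij, symmetric])
  also have "\<dots> \<le> (\<integral>\<^sup>+k. (if k = 0 then c else 0) + ennreal (4 * inverse (real k ^ 2)) \<partial>count_space UNIV)"
    by (intro nn_integral_mono le)
  also have "\<dots> = (\<integral>\<^sup>+k. (if k = (0::nat) then c else 0) \<partial>count_space UNIV) + (\<Sum>k. ennreal (4 * inverse (real k ^ 2)))"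
    unfolding nn_integral_count_space_nat[symmetric] by (rule nn_integral_add) auto
  also have "(\<Sum>k. ennreal (4 * inverse (real k ^ 2))) = ennreal (\<Sum>k. 4 * inverse (real k ^ 2))"
    by (intro suminf_ennreal2 summable_mult inverse_power_summable) auto
  also have "(\<integral>\<^sup>+k. (if k = (0::nat) then c else 0) \<partial>count_space UNIV) = (\<integral>\<^sup>+k. c * indicator {0::nat} k \<partial>count_space UNIV)"
    by (intro nn_integral_cong) (auto simp: indicator_def)
  also have "\<dots> = c" by (subst nn_integral_cmult_indicator) auto
  finally show ?thesis using that by (auto simp: top_unique)
qed

section \<open>Sparse times\<close>

context infinite_system
begin

definition correlation :: "('a \<Rightarrow> real) \<Rightarrow> int \<Rightarrow> ennreal" where
  "correlation f k = (\<integral>\<^sup>+x. ennreal (f x) * ennreal (f (iter k x)) \<partial>\<mu>)"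

lemma correlation_minus:
  assumes [measurable]: "f \<in> borel_measurable borel"
  shows "correlation f (- k) = correlation f k"
proof -
  have "correlation f (- k) = (\<integral>\<^sup>+x. ennreal (f (iter k x)) * ennreal (f (iter (- k) (iter k x))) \<partial>\<mu>)"
    unfolding correlation_def
    by (rule nn_integral_iter[of "\<lambda>x. ennreal (f x) * ennreal (f (iter (- k) x))" k, symmetric]) measurable
  then show ?thesis
    by (simp add: int_iterate_minus_cancel[OF bij_T] correlation_def mult.commute)
qed

text \<open>A whole window of correlations of \<open>f\<close> is dominated by a single correlation of the sum \<open>g\<close> of \<open>f\<close> over
\<open>L + 1\<close> consecutive times.\<close>

lemma correlation_window_small:
  assumes f: "integrable \<mu> f" and nonneg: "\<And>x. 0 \<le> f x" and le1: "\<And>x. f x \<le> (1::real)"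
    and "0 < e"
  shows "\<exists>m>L. \<forall>s. \<bar>s\<bar> \<le> int L \<longrightarrow> correlation f (int m + s) \<le> ennreal e"
proof -
  have [measurable]: "f \<in> borel_measurable borel" using f by (auto cong: measurable_cong_sets)
  define g where "g x = (\<Sum>a\<le>L. f ((T ^^ a) x))" for x
  have g: "integrable \<mu> g" unfolding g_def
    by (intro Bochner_Integration.integrable_sum integrable_funpow f)
  have g0: "0 \<le> g x" for x unfolding g_def by (intro sum_nonneg) (simp add: nonneg)
  have gL: "g x \<le> real (Suc L)" for x
  proof -
    have "g x \<le> (\<Sum>a\<le>L. 1)" unfolding g_def by (intro sum_mono le1)
    then show ?thesis by simp
  qed
  have gf: "f ((T ^^ a) x) \<le> g x" if "a \<le> L" for a x
    unfolding g_def using that by (intro member_le_sum) (auto simp: nonneg)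
  obtain m where m: "Suc L \<le> m" "(\<integral>x. g x * g ((T ^^ m) x) \<partial>\<mu>) < e"
    using correlation_small[OF g g0 gL \<open>0 < e\<close>, of "Suc L"] by auto
  have "correlation f (int m + s) \<le> ennreal e" if s: "\<bar>s\<bar> \<le> int L" for s
  proof -
    define a b where "a = nat (- s)" and "b = nat s"
    have ab: "a \<le> L" "b \<le> L" "s = int b - int a" using s by (auto simp: a_def b_def)
    have eq: "iter (int m + s) ((T ^^ a) x) = (T ^^ b) ((T ^^ m) x)" for x
      using int_iterate_add[OF bij_T, of "int m + s" "int a" x]
            int_iterate_add[OF bij_T, of "int b" "int m" x]
      unfolding ab(3) by (simp add: int_iterate_of_nat algebra_simps)
    have "correlation f (int m + s) = (\<integral>\<^sup>+x. ennreal (f ((T ^^ a) x)) * ennreal (f (iter (int m + s) ((T ^^ a) x))) \<partial>\<mu>)"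
      unfolding correlation_def
      using nn_integral_iter[of "\<lambda>x. ennreal (f x) * ennreal (f (iter (int m + s) x))" "int a"]
      by (simp add: int_iterate_of_nat)
    also have "\<dots> \<le> (\<integral>\<^sup>+x. ennreal (g x * g ((T ^^ m) x)) \<partial>\<mu>)"
      unfolding eq using ab gf g0
      by (intro nn_integral_mono) (simp add: ennreal_mult mult_mono ennreal_leI)
    also have "\<dots> = ennreal (\<integral>x. g x * g ((T ^^ m) x) \<partial>\<mu>)"
      by (intro nn_integral_eq_integral integrable_correlation[OF g g0 gL]) (simp add: g0)
    also have "\<dots> \<le> ennreal e" using m by (intro ennreal_leI) simp
    finally show ?thesis .
  qed
  then show ?thesis using m by (intro exI[of _ m]) auto
qed

text \<open>The windows cover all displacements that involve \<open>n i\<close> and smaller times only.\<close>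

lemma obtain_sparse_times:
  assumes f: "integrable \<mu> f" "\<And>x. 0 \<le> f x" "\<And>x. f x \<le> (1::real)"
  obtains n :: "nat \<Rightarrow> nat"
  where "\<And>i. (\<Sum>l<i. n l) < n i"
    and "\<And>i s. \<bar>s\<bar> \<le> int (\<Sum>l<i. n l) \<Longrightarrow> correlation f (int (n i) + s) \<le> ennreal ((1 / 4) ^ i)"
proof -
  have "\<exists>m>L. \<forall>s. \<bar>s\<bar> \<le> int L \<longrightarrow> correlation f (int m + s) \<le> ennreal ((1 / 4) ^ i)" for L i
    by (rule correlation_window_small[OF f]) simp
  then obtain h where h: "\<And>L i. L < h L i"
      "\<And>L i s. \<bar>s\<bar> \<le> int L \<Longrightarrow> correlation f (int (h L i) + s) \<le> ennreal ((1 / 4) ^ i)"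
    by metis
  \<comment> \<open>\<open>S i\<close> is the sum of the times before \<open>n i\<close>, which determines the window that \<open>n i\<close> has to respect\<close>
  define S where "S = rec_nat 0 (\<lambda>i L. L + h L i)"
  define n where "n i = h (S i) i" for i
  have S: "(\<Sum>l<i. n l) = S i" for i by (induction i) (simp_all add: S_def n_def)
  show ?thesis by (rule that[of n]) (simp_all only: S, simp_all add: n_def h)
qed

end

section \<open>The action of finite sets and its weight\<close>

text \<open>The sparse times are fixed together with the function \<open>f\<close> whose correlations they control, since \<open>f\<close>
later gives the weight.\<close>

locale cluster_system = infinite_system +
  fixes f :: "'a \<Rightarrow> real" and n :: "nat \<Rightarrow> nat"
  assumes integrable_f: "integrable \<mu> f" and f_pos: "\<And>x. 0 < f x" and f_le_1: "\<And>x. f x \<le> 1"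
    and sparse: "\<And>i. (\<Sum>l<i. n l) < n i"
    and correlation_le: "\<And>i s. \<bar>s\<bar> \<le> int (\<Sum>l<i. n l) \<Longrightarrow> correlation f (int (n i) + s) \<le> ennreal ((1 / 4) ^ i)"
begin

lemma measurable_f [measurable]: "f \<in> borel_measurable borel"
  using integrable_f by (auto cong: measurable_cong_sets)

definition finite_sets :: "nat set measure" where
  "finite_sets = count_space {F. finite F}"

lemma countable_finite_sets: "countable {F :: nat set. finite F}"
  by (rule countable_Collect_finite)

abbreviation marked :: "('a \<times> (nat \<Rightarrow> bool)) measure" where
  "marked \<equiv> \<mu> \<Otimes>\<^sub>M coin"

definition act :: "nat set \<Rightarrow> 'a \<times> (nat \<Rightarrow> bool) \<Rightarrow> 'a \<times> (nat \<Rightarrow> bool)" where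
  "act F z = (iter (displacement n F (snd z)) (fst z), flip F (snd z))"

lemma displacement_decompose:
  assumes "finite F" "F \<noteq> {}"
  obtains s where "\<bar>s\<bar> \<le> int (\<Sum>l<Max F. n l)"
    "displacement n F \<epsilon> = int (n (Max F)) + s \<or> displacement n F \<epsilon> = - (int (n (Max F)) + s)"
proof -
  let ?G = "F - {Max F}"
  have "?G \<subseteq> {..<Max F}" using assms by (auto simp: less_le)
  then have "\<bar>displacement n ?G \<epsilon>\<bar> \<le> int (\<Sum>l<Max F. n l)"
    using abs_displacement_le[of ?G "Max F" n \<epsilon>] assms by simp
  moreover have "displacement n F \<epsilon> = (if \<epsilon> (Max F) then - int (n (Max F)) else int (n (Max F))) + displacement n ?G \<epsilon>"
    unfolding displacement_def using assms by (intro sum.remove) auto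
  ultimately show ?thesis
    using that[of "displacement n ?G \<epsilon>"] that[of "- displacement n ?G \<epsilon>"] by (cases "\<epsilon> (Max F)") auto
qed

lemma displacement_nonzero:
  assumes "finite F" "F \<noteq> {}"
  shows "displacement n F \<epsilon> \<noteq> 0"
proof -
  obtain s where "\<bar>s\<bar> \<le> int (\<Sum>l<Max F. n l)"
    "displacement n F \<epsilon> = int (n (Max F)) + s \<or> displacement n F \<epsilon> = - (int (n (Max F)) + s)"
    using displacement_decompose[OF assms, of \<epsilon>] .
  moreover have "int (\<Sum>l<Max F. n l) < int (n (Max F))" using sparse[of "Max F"] by linarith
  ultimately show ?thesis by linarith
qed

text \<open>By the cocycle property the difference of the two displacements is the displacement by the symmetric
difference, where the largest time dominates the sum of all the others.\<close>

lemma displacement_inj: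
  assumes "finite F" "finite G" "displacement n F \<epsilon> = displacement n G \<epsilon>"
  shows "F = G"
proof (rule ccontr)
  assume "F \<noteq> G"
  have "displacement n (sym_diff (sym_diff F G) G) \<epsilon> = displacement n G \<epsilon> + displacement n (sym_diff F G) (flip G \<epsilon>)"
    using assms by (intro displacement_cocycle) auto
  moreover have "sym_diff (sym_diff F G) G = F" by auto
  ultimately have "displacement n (sym_diff F G) (flip G \<epsilon>) = 0" using assms by simp
  then show False using displacement_nonzero[of "sym_diff F G" "flip G \<epsilon>"] assms \<open>F \<noteq> G\<close> by auto
qed

lemma correlation_displacement_le:
  assumes "finite F"
  shows "correlation f (displacement n F \<epsilon>) \<le> (if F = {} then correlation f 0 else ennreal ((1 / 4) ^ Max F))"
proof (cases "F = {}")
  case True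
  then show ?thesis by (simp add: displacement_def)
next
  case False
  obtain s where s: "\<bar>s\<bar> \<le> int (\<Sum>l<Max F. n l)"
    "displacement n F \<epsilon> = int (n (Max F)) + s \<or> displacement n F \<epsilon> = - (int (n (Max F)) + s)"
    using displacement_decompose[OF assms False, of \<epsilon>] .
  then have "correlation f (displacement n F \<epsilon>) = correlation f (int (n (Max F)) + s)"
    using correlation_minus[OF measurable_f] by metis
  then show ?thesis using correlation_le[OF s(1)] False by simp
qed

lemma act_act:
  assumes "finite F" "finite G"
  shows "act F (act G z) = act (sym_diff F G) z"
  by (simp add: act_def displacement_cocycle[OF assms] flip_flip[of F G] int_iterate_add[OF bij_T, symmetric] add.commute)

lemma act_empty [simp]: "act {} z = z"
  by (simp add: act_def displacement_def flip_def)

lemma act_act_same: "finite F \<Longrightarrow> act F (act F z) = z"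
  by (simp add: act_act)

lemma measurable_act [measurable]: "act F \<in> marked \<rightarrow>\<^sub>M marked"
proof -
  have [measurable]: "iter k \<in> \<mu> \<rightarrow>\<^sub>M \<mu>" for k
    by (subst measurable_cong_sets[OF sets_\<mu> sets_\<mu>]) (rule measurable_iter)
  have "(\<lambda>z. displacement n F (snd z)) \<in> marked \<rightarrow>\<^sub>M count_space UNIV" by measurable
  then have [measurable]: "(\<lambda>z. iter (displacement n F (snd z)) (fst z)) \<in> marked \<rightarrow>\<^sub>M \<mu>"
    by (rule measurable_compose_countable[rotated]) measurable
  show ?thesis unfolding act_def[abs_def] by measurable
qed

lemma nn_integral_act:
  assumes [measurable]: "h \<in> borel_measurable marked"
  shows "(\<integral>\<^sup>+z. h (act F z) \<partial>marked) = (\<integral>\<^sup>+z. h z \<partial>marked)"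
proof -
  interpret coin: prob_space coin by (rule prob_space_coin)
  interpret pair_sigma_finite \<mu> coin ..
  have "(\<integral>\<^sup>+z. h (act F z) \<partial>marked) = (\<integral>\<^sup>+\<epsilon>. \<integral>\<^sup>+x. h (act F (x, \<epsilon>)) \<partial>\<mu> \<partial>coin)"
    by (rule nn_integral_snd[symmetric]) measurable
  also have "\<dots> = (\<integral>\<^sup>+\<epsilon>. \<integral>\<^sup>+x. h (x, flip F \<epsilon>) \<partial>\<mu> \<partial>coin)"
  proof (rule nn_integral_cong)
    fix \<epsilon>
    have "(\<lambda>x. h (x, flip F \<epsilon>)) \<in> borel_measurable \<mu>" by measurable
    then show "(\<integral>\<^sup>+x. h (act F (x, \<epsilon>)) \<partial>\<mu>) = (\<integral>\<^sup>+x. h (x, flip F \<epsilon>) \<partial>\<mu>)"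
      unfolding act_def using nn_integral_iter[of "\<lambda>x. h (x, flip F \<epsilon>)"]
      by (simp cong: measurable_cong_sets[OF sets_\<mu>])
  qed
  also have "\<dots> = (\<integral>\<^sup>+\<epsilon>. \<integral>\<^sup>+x. h (x, \<epsilon>) \<partial>\<mu> \<partial>coin)"
    by (rule nn_integral_flip[of "\<lambda>\<epsilon>. \<integral>\<^sup>+x. h (x, \<epsilon>) \<partial>\<mu>"]) measurable
  also have "\<dots> = (\<integral>\<^sup>+z. h z \<partial>marked)"
    by (rule nn_integral_snd) measurable
  finally show ?thesis .
qed

definition orbit_sum :: "('a \<times> (nat \<Rightarrow> bool) \<Rightarrow> ennreal) \<Rightarrow> 'a \<times> (nat \<Rightarrow> bool) \<Rightarrow> ennreal" where
  "orbit_sum h z = (\<integral>\<^sup>+F. h (act F z) \<partial>finite_sets)"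

lemma measurable_orbit_sum [measurable]:
  assumes [measurable]: "h \<in> borel_measurable marked"
  shows "orbit_sum h \<in> borel_measurable marked"
proof -
  interpret sigma_finite_measure finite_sets
    unfolding finite_sets_def by (rule sigma_finite_measure_count_space_countable) (rule countable_finite_sets)
  have "(\<lambda>p. h (act (fst p) (snd p))) \<in> borel_measurable (finite_sets \<Otimes>\<^sub>M marked)"
    unfolding finite_sets_def using countable_finite_sets
    by (intro measurable_pair_measure_countable1) auto
  from measurable_compose[OF measurable_pair_swap' this]
  have "(\<lambda>(z, F). h (act F z)) \<in> borel_measurable (marked \<Otimes>\<^sub>M finite_sets)"
    by (simp add: split_def)
  then show ?thesis unfolding orbit_sum_def[abs_def] by (intro borel_measurable_nn_integral) simp
qed

lemma nn_integral_orbit_sum: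
  assumes [measurable]: "h \<in> borel_measurable marked" "u \<in> borel_measurable marked"
  shows "(\<integral>\<^sup>+z. u z * orbit_sum h z \<partial>marked) = (\<integral>\<^sup>+F. \<integral>\<^sup>+z. u z * h (act F z) \<partial>marked \<partial>finite_sets)"
proof -
  have "(\<integral>\<^sup>+z. u z * orbit_sum h z \<partial>marked) = (\<integral>\<^sup>+z. \<integral>\<^sup>+F. u z * h (act F z) \<partial>finite_sets \<partial>marked)"
    unfolding orbit_sum_def by (simp add: nn_integral_cmult finite_sets_def)
  also have "\<dots> = (\<integral>\<^sup>+F. \<integral>\<^sup>+z. u z * h (act F z) \<partial>marked \<partial>finite_sets)"
    unfolding finite_sets_def by (intro nn_integral_count_space_nn_integral countable_finite_sets) measurable
  finally show ?thesis .
qed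

text \<open>Mass transport: the action preserves the measure and every group element is its own inverse, so mass
\<open>u z * h (act F z)\<close> may be counted at either end.\<close>

lemma orbit_sum_swap:
  assumes [measurable]: "h \<in> borel_measurable marked" "u \<in> borel_measurable marked"
  shows "(\<integral>\<^sup>+z. u z * orbit_sum h z \<partial>marked) = (\<integral>\<^sup>+z. h z * orbit_sum u z \<partial>marked)"
proof -
  have "(\<integral>\<^sup>+F. \<integral>\<^sup>+z. u z * h (act F z) \<partial>marked \<partial>finite_sets) = (\<integral>\<^sup>+F. \<integral>\<^sup>+z. h z * u (act F z) \<partial>marked \<partial>finite_sets)"
  proof (rule nn_integral_cong)
    fix F assume "F \<in> space finite_sets"
    then have "finite F" by (simp add: finite_sets_def)
    then show "(\<integral>\<^sup>+z. u z * h (act F z) \<partial>marked) = (\<integral>\<^sup>+z. h z * u (act F z) \<partial>marked)"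
      using nn_integral_act[of "\<lambda>z. h z * u (act F z)" F] by (simp add: act_act_same mult.commute)
  qed
  then show ?thesis by (simp add: nn_integral_orbit_sum)
qed

lemma orbit_sum_act:
  assumes "finite G"
  shows "orbit_sum h (act G z) = orbit_sum h z"
proof -
  have "bij_betw (\<lambda>F. sym_diff F G) {F. finite F} {F. finite F}"
    by (rule bij_betwI[of _ _ _ "\<lambda>F. sym_diff F G"]) (use assms in auto)
  then have "(\<integral>\<^sup>+F. h (act (sym_diff F G) z) \<partial>finite_sets) = (\<integral>\<^sup>+F. h (act F z) \<partial>finite_sets)"
    unfolding finite_sets_def by (rule nn_integral_bij_count_space)
  moreover have "(\<integral>\<^sup>+F. h (act F (act G z)) \<partial>finite_sets) = (\<integral>\<^sup>+F. h (act (sym_diff F G) z) \<partial>finite_sets)"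
    by (rule nn_integral_cong) (simp add: finite_sets_def act_act assms)
  ultimately show ?thesis by (simp add: orbit_sum_def)
qed

abbreviation marked_f :: "'a \<times> (nat \<Rightarrow> bool) \<Rightarrow> ennreal" where
  "marked_f z \<equiv> ennreal (f (fst z))"

lemma measurable_marked_f [measurable]: "marked_f \<in> borel_measurable marked"
proof -
  have [measurable]: "f \<in> borel_measurable \<mu>" using integrable_f by auto
  show ?thesis by measurable
qed

text \<open>The integral of \<open>f\<close> times its orbit sum is the sum of the correlations along all displacements.\<close>

lemma orbit_sum_f_finite: "AE z in marked. orbit_sum marked_f z \<noteq> \<infinity>"
proof -
  interpret coin: prob_space coin by (rule prob_space_coin)
  interpret pair_sigma_finite \<mu> coin ..
  have corr0: "correlation f 0 \<noteq> \<infinity>"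
  proof -
    have "correlation f 0 \<le> (\<integral>\<^sup>+x. ennreal (f x) \<partial>\<mu>)"
      unfolding correlation_def using f_le_1 less_imp_le[OF f_pos]
      by (intro nn_integral_mono) (simp add: ennreal_mult[symmetric] ennreal_leI mult_left_le_one_le)
    also have "\<dots> < \<infinity>"
      using integrable_f less_imp_le[OF f_pos] by (simp add: nn_integral_eq_integral)
    finally show ?thesis by simp
  qed
  have "(\<integral>\<^sup>+z. marked_f z * orbit_sum marked_f z \<partial>marked) = (\<integral>\<^sup>+F. \<integral>\<^sup>+z. marked_f z * marked_f (act F z) \<partial>marked \<partial>finite_sets)"
    by (rule nn_integral_orbit_sum) measurable
  also have "\<dots> \<le> (\<integral>\<^sup>+F. (if F = {} then correlation f 0 else ennreal ((1 / 4) ^ Max F)) \<partial>finite_sets)"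
  proof (rule nn_integral_mono)
    fix F assume "F \<in> space finite_sets"
    then have F: "finite F" by (simp add: finite_sets_def)
    have "(\<integral>\<^sup>+z. marked_f z * marked_f (act F z) \<partial>marked) = (\<integral>\<^sup>+\<epsilon>. \<integral>\<^sup>+x. marked_f (x, \<epsilon>) * marked_f (act F (x, \<epsilon>)) \<partial>\<mu> \<partial>coin)"
      by (rule nn_integral_snd[symmetric]) measurable
    also have "\<dots> = (\<integral>\<^sup>+\<epsilon>. correlation f (displacement n F \<epsilon>) \<partial>coin)"
      by (simp add: act_def correlation_def)
    also have "\<dots> \<le> (\<integral>\<^sup>+\<epsilon>. (if F = {} then correlation f 0 else ennreal ((1 / 4) ^ Max F)) \<partial>coin)"
      by (intro nn_integral_mono correlation_displacement_le F)
    also have "\<dots> = (if F = {} then correlation f 0 else ennreal ((1 / 4) ^ Max F))"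
      using coin.emeasure_space_1 by simp
    finally show "(\<integral>\<^sup>+z. marked_f z * marked_f (act F z) \<partial>marked) \<le> \<dots>" .
  qed
  also have "\<dots> < \<infinity>"
    using finite_sum_over_finite_sets[OF corr0] by (simp add: finite_sets_def less_top)
  finally have "AE z in marked. marked_f z * orbit_sum marked_f z \<noteq> \<infinity>"
    by (intro nn_integral_PInf_AE) auto
  then show ?thesis
  proof eventually_elim
    case (elim z)
    have "marked_f z \<noteq> 0" using f_pos[of "fst z"] by simp
    then show ?case using elim by (simp add: ennreal_mult_eq_top_iff)
  qed
qed

text \<open>A fractional choice of one representative in each group orbit.\<close>

definition weight :: "'a \<times> (nat \<Rightarrow> bool) \<Rightarrow> ennreal" where
  "weight z = marked_f z / orbit_sum marked_f z"

lemma measurable_weight [measurable]: "weight \<in> borel_measurable marked"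
  unfolding weight_def[abs_def] by measurable

lemma f_le_orbit_sum: "marked_f z \<le> orbit_sum marked_f z"
proof -
  have "marked_f z = (\<integral>\<^sup>+F. marked_f z * indicator {{}} F \<partial>finite_sets)"
    unfolding finite_sets_def by (subst nn_integral_cmult_indicator) auto
  also have "\<dots> \<le> orbit_sum marked_f z"
    unfolding orbit_sum_def by (intro nn_integral_mono) (auto simp: indicator_def)
  finally show ?thesis .
qed

lemma orbit_sum_f_pos: "0 < orbit_sum marked_f z"
proof -
  have "0 < marked_f z" using f_pos[of "fst z"] by simp
  also note f_le_orbit_sum[of z]
  finally show ?thesis .
qed

lemma weight_le_1: "weight z \<le> 1"
  unfolding weight_def using f_le_orbit_sum[of z] orbit_sum_f_pos[of z]
  by (cases "orbit_sum marked_f z = \<infinity>") (auto simp: less_top[symmetric] intro: divide_le_posI_ennreal)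

lemma orbit_sum_weight: "AE z in marked. orbit_sum weight z = 1"
  using orbit_sum_f_finite
proof eventually_elim
  case (elim z)
  have "orbit_sum weight z = (\<integral>\<^sup>+F. marked_f (act F z) / orbit_sum marked_f z \<partial>finite_sets)"
    unfolding orbit_sum_def[of weight] weight_def
    by (intro nn_integral_cong) (simp add: orbit_sum_act finite_sets_def)
  also have "\<dots> = orbit_sum marked_f z / orbit_sum marked_f z"
    unfolding orbit_sum_def[of marked_f] by (rule nn_integral_divide) (simp add: finite_sets_def)
  also have "\<dots> = 1" using elim orbit_sum_f_pos[of z] by (intro ennreal_divide_self) (auto simp: less_top[symmetric])
  finally show ?case .
qed

text \<open>Choosing representatives by their weight and then summing \<open>u\<close> over their orbits counts every marked
point once.\<close>

lemma weighted_orbit_sum: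
  assumes [measurable]: "u \<in> borel_measurable marked"
  shows "(\<integral>\<^sup>+z. weight z * orbit_sum u z \<partial>marked) = (\<integral>\<^sup>+z. u z \<partial>marked)"
proof -
  have "(\<integral>\<^sup>+z. weight z * orbit_sum u z \<partial>marked) = (\<integral>\<^sup>+z. u z * orbit_sum weight z \<partial>marked)"
    by (rule orbit_sum_swap) measurable
  also have "\<dots> = (\<integral>\<^sup>+z. u z \<partial>marked)"
    using orbit_sum_weight by (intro nn_integral_cong_AE) (auto elim: eventually_mono)
  finally show ?thesis .
qed

definition base_map :: "'a \<times> (nat \<Rightarrow> bool) \<Rightarrow> 'a \<times> (nat \<Rightarrow> bool)" where
  "base_map z = (T (fst z), snd z)"

lemma measurable_base_map [measurable]: "base_map \<in> marked \<rightarrow>\<^sub>M marked"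
  unfolding base_map_def[abs_def] by measurable

lemma act_base_map: "act F (base_map z) = base_map (act F z)"
  by (simp add: act_def base_map_def int_iterate_T[OF bij_T])

lemma nn_integral_base_map:
  assumes [measurable]: "h \<in> borel_measurable marked"
  shows "(\<integral>\<^sup>+z. h (base_map z) \<partial>marked) = (\<integral>\<^sup>+z. h z \<partial>marked)"
proof -
  interpret coin: prob_space coin by (rule prob_space_coin)
  interpret pair_sigma_finite \<mu> coin ..
  have "(\<integral>\<^sup>+z. h (base_map z) \<partial>marked) = (\<integral>\<^sup>+\<epsilon>. \<integral>\<^sup>+x. h (base_map (x, \<epsilon>)) \<partial>\<mu> \<partial>coin)"
    by (rule nn_integral_snd[symmetric]) measurable
  also have "\<dots> = (\<integral>\<^sup>+\<epsilon>. \<integral>\<^sup>+x. h (x, \<epsilon>) \<partial>\<mu> \<partial>coin)"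
  proof (rule nn_integral_cong)
    fix \<epsilon>
    have "(\<lambda>x. h (x, \<epsilon>)) \<in> borel_measurable \<mu>" by measurable
    then show "(\<integral>\<^sup>+x. h (base_map (x, \<epsilon>)) \<partial>\<mu>) = (\<integral>\<^sup>+x. h (x, \<epsilon>) \<partial>\<mu>)"
      unfolding base_map_def using nn_integral_funpow[of "\<lambda>x. h (x, \<epsilon>)" 1] by simp
  qed
  also have "\<dots> = (\<integral>\<^sup>+z. h z \<partial>marked)"
    by (rule nn_integral_snd) measurable
  finally show ?thesis .
qed

lemma distr_base_map: "distr marked marked base_map = marked"
proof (rule measure_eqI)
  fix A assume A: "A \<in> sets (distr marked marked base_map)"
  then have [measurable]: "A \<in> sets marked" by simp
  have "emeasure (distr marked marked base_map) A = (\<integral>\<^sup>+z. indicator A z \<partial>distr marked marked base_map)"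
    using A by simp
  also have "\<dots> = (\<integral>\<^sup>+z. indicator A (base_map z) \<partial>marked)" by (rule nn_integral_distr) measurable
  also have "\<dots> = emeasure marked A" by (subst nn_integral_base_map) simp_all
  finally show "emeasure (distr marked marked base_map) A = emeasure marked A" .
qed simp

text \<open>Since \<open>base_map\<close> commutes with the action, the weight composed with it also sums to \<open>1\<close> along group orbits.
Two such functions \<open>w\<close> and \<open>w'\<close> have the same integral over an invariant set: the integral of \<open>w\<close> times the
orbit sum of \<open>w'\<close> equals, by mass transport, that of \<open>w'\<close> times the orbit sum of \<open>w\<close>.\<close>

lemma weighted_invariant_set:
  assumes [measurable]: "E \<in> sets marked"
    and inv: "\<And>F z. finite F \<Longrightarrow> act F z \<in> E \<longleftrightarrow> z \<in> E"
  shows "(\<integral>\<^sup>+z. weight z * indicator E (base_map z) \<partial>marked) = (\<integral>\<^sup>+z. weight z * indicator E z \<partial>marked)"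
proof -
  let ?u = "\<lambda>z. weight (base_map z) * indicator E (base_map z)"
  have sum_base_map: "AE z in marked. orbit_sum weight (base_map z) = 1"
  proof -
    have "AE z in distr marked marked base_map. orbit_sum weight z = 1"
      using orbit_sum_weight by (subst distr_base_map)
    then show ?thesis by (subst (asm) AE_distr_iff) simp_all
  qed
  have "(\<integral>\<^sup>+z. weight z * indicator E (base_map z) \<partial>marked) = (\<integral>\<^sup>+z. weight z * orbit_sum ?u z \<partial>marked)"
  proof (rule nn_integral_cong_AE)
    show "AE z in marked. weight z * indicator E (base_map z) = weight z * orbit_sum ?u z"
      using sum_base_map
    proof eventually_elim
      case (elim z)
      have "orbit_sum ?u z = (\<integral>\<^sup>+F. weight (act F (base_map z)) * indicator E (base_map z) \<partial>finite_sets)"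
        unfolding orbit_sum_def
        by (intro nn_integral_cong) (auto simp: finite_sets_def act_base_map[symmetric] inv indicator_def)
      also have "\<dots> = orbit_sum weight (base_map z) * indicator E (base_map z)"
        unfolding orbit_sum_def by (rule nn_integral_multc) (simp add: finite_sets_def)
      finally show ?case using elim by simp
    qed
  qed
  also have "\<dots> = (\<integral>\<^sup>+z. ?u z \<partial>marked)" by (rule weighted_orbit_sum) measurable
  also have "\<dots> = (\<integral>\<^sup>+z. weight z * indicator E z \<partial>marked)"
    by (rule nn_integral_base_map[of "\<lambda>z. weight z * indicator E z"]) measurable
  finally show ?thesis .
qed

end

section \<open>Poisson sampling of a sigma-finite measure\<close>

lemma ennreal_of_nat_eq_suminf: "(\<Sum>k. indicator {..<n::nat} k) = (of_nat n :: ennreal)"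
  by (subst suminf_finite[of "{..<n}"]) auto

text \<open>The probability generating function of the Poisson distribution. Read with \<open>s\<close> the probability that one
sample avoids a set, it is the probability that a Poisson number of independent samples avoids it.\<close>

lemma poisson_power_series:
  assumes "0 < c" "0 \<le> s"
  shows "(\<integral>\<^sup>+K. ennreal s ^ K \<partial>measure_pmf (poisson_pmf c)) = ennreal (exp (- c * (1 - s)))"
proof -
  have sums: "(\<lambda>k. exp (- c) * ((c * s) ^ k /\<^sub>R fact k)) sums (exp (- c) * exp (c * s))"
    by (intro sums_mult exp_converges)
  have "(\<integral>\<^sup>+K. ennreal s ^ K \<partial>measure_pmf (poisson_pmf c)) = (\<Sum>k. ennreal (exp (- c) * ((c * s) ^ k /\<^sub>R fact k)))"
    using assms
    by (auto simp: nn_integral_measure_pmf nn_integral_count_space_nat ennreal_power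
        ennreal_mult[symmetric] power_mult_distrib field_simps intro!: suminf_cong)
  also have "\<dots> = ennreal (exp (- c) * exp (c * s))"
    using sums assms by (intro suminf_ennreal_eq) auto
  finally show ?thesis by (simp add: exp_add[symmetric] algebra_simps)
qed

lemma poisson_mean:
  assumes "0 < c"
  shows "(\<integral>\<^sup>+K. of_nat K \<partial>measure_pmf (poisson_pmf c)) = ennreal c"
proof -
  let ?f = "\<lambda>k. exp (- c) * (c ^ k / fact k) * real k"
  have "(\<lambda>k. c * exp (- c) * (c ^ k /\<^sub>R fact k)) sums (c * exp (- c) * exp c)"
    by (intro sums_mult exp_converges)
  moreover have "c * exp (- c) * (c ^ k /\<^sub>R fact k) = ?f (Suc k)" for k
    by (simp add: field_simps del: of_nat_Suc)
  moreover have "c * exp (- c) * exp c = c" by (simp add: exp_minus)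
  ultimately have "(\<lambda>k. ?f (Suc k)) sums c" by (simp only:)
  then have sums: "?f sums c" using sums_Suc_iff[of ?f c] by simp
  have "(\<integral>\<^sup>+K. of_nat K \<partial>measure_pmf (poisson_pmf c)) = (\<Sum>k. ennreal (?f k))"
    using assms
    by (auto simp: nn_integral_measure_pmf nn_integral_count_space_nat
        ennreal_mult[symmetric] ennreal_of_nat_eq_real_of_nat field_simps intro!: suminf_cong)
  also have "\<dots> = ennreal c"
    using sums assms by (intro suminf_ennreal_eq) auto
  finally show ?thesis .
qed

lemma distr_PiM_two_components:
  assumes "prob_space N" "i \<noteq> j" "i \<in> I" "j \<in> I"
  shows "distr (PiM I (\<lambda>_. N)) (N \<Otimes>\<^sub>M N) (\<lambda>\<omega>. (\<omega> i, \<omega> j)) = N \<Otimes>\<^sub>M N"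
proof -
  interpret N: prob_space N by fact
  have "N \<Otimes>\<^sub>M N = distr (PiM I (\<lambda>_. N)) (N \<Otimes>\<^sub>M N) (\<lambda>\<omega>. (\<omega> i, \<omega> j))"
  proof (rule pair_measure_eqI)
    fix A B assume AB: "A \<in> sets N" "B \<in> sets N"
    let ?C = "\<lambda>l. if l = i then A else B"
    have "emeasure (distr (PiM I (\<lambda>_. N)) (N \<Otimes>\<^sub>M N) (\<lambda>\<omega>. (\<omega> i, \<omega> j))) (A \<times> B)
        = emeasure (PiM I (\<lambda>_. N)) ((\<lambda>\<omega>. (\<omega> i, \<omega> j)) -` (A \<times> B) \<inter> space (PiM I (\<lambda>_. N)))"
      using AB assms by (intro emeasure_distr) auto
    also have "(\<lambda>\<omega>. (\<omega> i, \<omega> j)) -` (A \<times> B) \<inter> space (PiM I (\<lambda>_. N)) = prod_emb I (\<lambda>_. N) {i, j} (Pi\<^sub>E {i, j} ?C)"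
      using assms by (auto simp: prod_emb_def space_PiM)
    also have "emeasure (PiM I (\<lambda>_. N)) \<dots> = (\<Prod>l\<in>{i, j}. emeasure N (?C l))"
      using AB assms by (intro emeasure_PiM_emb) auto
    also have "\<dots> = emeasure N A * emeasure N B" using assms by simp
    finally show "emeasure N A * emeasure N B = emeasure (distr (PiM I (\<lambda>_. N)) (N \<Otimes>\<^sub>M N) (\<lambda>\<omega>. (\<omega> i, \<omega> j))) (A \<times> B)" ..
  qed (simp_all add: N.sigma_finite_measure_axioms)
  then show ?thesis ..
qed

lemma AE_PiM_two_components:
  assumes "prob_space N" "i \<noteq> j" "i \<in> I" "j \<in> I" and "AE p in N \<Otimes>\<^sub>M N. P (fst p) (snd p)"
  shows "AE \<omega> in PiM I (\<lambda>_. N). P (\<omega> i) (\<omega> j)"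
proof -
  have "AE p in distr (PiM I (\<lambda>_. N)) (N \<Otimes>\<^sub>M N) (\<lambda>\<omega>. (\<omega> i, \<omega> j)). P (fst p) (snd p)"
    using assms(5) by (subst distr_PiM_two_components[OF assms(1-4)])
  from AE_distrD[OF _ this] show ?thesis using assms by simp
qed

text \<open>A Poisson process with intensity \<open>c \<cdot> m \<cdot> \<rho>\<close> is the superposition over the levels \<open>k\<close> of independent Poisson
processes with intensities \<open>c \<cdot> \<rho>\<close> restricted to \<open>{z. k < m z}\<close>. As \<open>m\<close> takes integer values, all levels
can be obtained from identical ones, consisting of a Poisson number of independent samples from the
probability \<open>\<rho>\<close>, by deleting samples; and every nonzero sigma-finite measure has this form.\<close>

locale poisson_sampling = prob_space \<rho> for \<rho> :: "'z measure" +
  fixes c :: real and m :: "'z \<Rightarrow> nat"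
  assumes c_pos: "0 < c" and measurable_m [measurable]: "m \<in> \<rho> \<rightarrow>\<^sub>M count_space UNIV"
begin

definition level :: "(nat \<times> (nat \<Rightarrow> 'z)) measure" where
  "level = measure_pmf (poisson_pmf c) \<Otimes>\<^sub>M PiM UNIV (\<lambda>_. \<rho>)"

definition sampling :: "(nat \<Rightarrow> nat \<times> (nat \<Rightarrow> 'z)) measure" where
  "sampling = PiM UNIV (\<lambda>_. level)"

text \<open>The index \<open>(k, j)\<close> stands for sample \<open>j\<close> of level \<open>k\<close>. It is active if \<open>j\<close> is below the Poisson number of the
level and the sample is not deleted there.\<close>

definition active :: "nat \<times> nat \<Rightarrow> (nat \<Rightarrow> nat \<times> (nat \<Rightarrow> 'z)) \<Rightarrow> bool" where
  "active i q \<longleftrightarrow> snd i < fst (q (fst i)) \<and> fst i < m (snd (q (fst i)) (snd i))"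

definition point :: "nat \<times> nat \<Rightarrow> (nat \<Rightarrow> nat \<times> (nat \<Rightarrow> 'z)) \<Rightarrow> 'z" where
  "point i q = snd (q (fst i)) (snd i)"

definition sampled :: "'z measure" where
  "sampled = density \<rho> (\<lambda>z. ennreal c * of_nat (m z))"

lemma prob_space_PiM_\<rho>: "prob_space (PiM UNIV (\<lambda>_::nat. \<rho>))"
  by (intro prob_space_PiM prob_space_axioms)

lemma prob_space_level: "prob_space level"
proof -
  interpret A: prob_space "PiM UNIV (\<lambda>_::nat. \<rho>)" by (rule prob_space_PiM_\<rho>)
  interpret B: prob_space "measure_pmf (poisson_pmf c)" by (rule prob_space_measure_pmf)
  interpret pair_prob_space "measure_pmf (poisson_pmf c)" "PiM UNIV (\<lambda>_::nat. \<rho>)" ..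
  show ?thesis unfolding level_def by (rule prob_space_axioms)
qed

lemma prob_space_sampling: "prob_space sampling"
  unfolding sampling_def by (intro prob_space_PiM prob_space_level)

lemma measurable_number [measurable]: "fst \<in> level \<rightarrow>\<^sub>M count_space UNIV"
  unfolding level_def by (rule measurable_compose[OF measurable_fst]) simp

lemma measurable_position [measurable]: "(\<lambda>l. snd l j) \<in> level \<rightarrow>\<^sub>M \<rho>"
  unfolding level_def by measurable

lemma measurable_level_component [measurable]: "(\<lambda>q. q k) \<in> sampling \<rightarrow>\<^sub>M level"
  unfolding sampling_def by measurable

lemma measurable_point [measurable]: "point i \<in> sampling \<rightarrow>\<^sub>M \<rho>"
  unfolding point_def[abs_def]
  by (rule measurable_compose[OF measurable_level_component measurable_position])

lemma measurable_active [measurable]: "Measurable.pred sampling (active i)"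
proof -
  have [measurable]: "(\<lambda>q. fst (q k)) \<in> sampling \<rightarrow>\<^sub>M count_space UNIV" for k
    by (rule measurable_compose[OF measurable_level_component measurable_number])
  have [measurable]: "(\<lambda>q. snd (q k) j) \<in> sampling \<rightarrow>\<^sub>M \<rho>" for k j
    by (rule measurable_compose[OF measurable_level_component measurable_position])
  show ?thesis unfolding active_def[abs_def] by measurable
qed

lemma nn_integral_sampled:
  assumes [measurable]: "g \<in> borel_measurable \<rho>"
  shows "(\<integral>\<^sup>+z. g z \<partial>sampled) = (\<Sum>k. \<integral>\<^sup>+z. ennreal c * (indicator {..<m z} k * g z) \<partial>\<rho>)"
proof -
  have [measurable]: "(\<lambda>z. of_nat (m z) :: ennreal) \<in> borel_measurable \<rho>"
    by (rule measurable_compose[OF measurable_m]) simp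
  have [measurable]: "(\<lambda>z. indicator {..<m z} k :: ennreal) \<in> borel_measurable \<rho>" for k
    by (rule measurable_compose[OF measurable_m]) simp
  have "(\<integral>\<^sup>+z. g z \<partial>sampled) = (\<integral>\<^sup>+z. (\<Sum>k. ennreal c * (indicator {..<m z} k * g z)) \<partial>\<rho>)"
    unfolding sampled_def
    by (subst nn_integral_density)
       (simp_all add: ennreal_of_nat_eq_suminf[symmetric] mult.assoc)
  also have "\<dots> = (\<Sum>k. \<integral>\<^sup>+z. ennreal c * (indicator {..<m z} k * g z) \<partial>\<rho>)"
    by (rule nn_integral_suminf) measurable
  finally show ?thesis .
qed

lemma nn_integral_points:
  assumes [measurable]: "g \<in> borel_measurable \<rho>"
  shows "(\<integral>\<^sup>+i. \<integral>\<^sup>+q. (if active i q then g (point i q) else 0) \<partial>sampling \<partial>count_space UNIV) = (\<integral>\<^sup>+z. g z \<partial>sampled)"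
proof -
  interpret A: prob_space "PiM UNIV (\<lambda>_::nat. \<rho>)" by (rule prob_space_PiM_\<rho>)
  interpret L: prob_space level by (rule prob_space_level)
  interpret P: product_prob_space "\<lambda>_::nat. \<rho>" UNIV ..
  interpret Q: product_prob_space "\<lambda>_::nat. level" UNIV ..
  have [measurable]: "(\<lambda>z. indicator {..<m z} k :: ennreal) \<in> borel_measurable \<rho>" for k
    by (rule measurable_compose[OF measurable_m]) simp
  let ?g = "\<lambda>k z. indicator {..<m z} k * g z"
  have one: "(\<integral>\<^sup>+q. (if active (k, j) q then g (point (k, j) q) else 0) \<partial>sampling)
    = emeasure (measure_pmf (poisson_pmf c)) {j<..} * (\<integral>\<^sup>+z. ?g k z \<partial>\<rho>)" for k j
  proof -
    have h: "(\<lambda>l. indicator {j<..} (fst l) * ?g k (snd l j)) \<in> borel_measurable level"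
    proof -
      have "(\<lambda>l. ?g k (snd l j)) \<in> borel_measurable level"
        by (rule measurable_compose[OF measurable_position]) measurable
      moreover have "(\<lambda>l. indicator {j<..} (fst l) :: ennreal) \<in> borel_measurable level"
        by (rule measurable_compose[OF measurable_number]) simp
      ultimately show ?thesis by simp
    qed
    have "(\<integral>\<^sup>+q. (if active (k, j) q then g (point (k, j) q) else 0) \<partial>sampling)
        = (\<integral>\<^sup>+q. indicator {j<..} (fst (q k)) * ?g k (snd (q k) j) \<partial>sampling)"
      by (intro nn_integral_cong) (auto simp: active_def point_def indicator_def)
    also have "\<dots> = (\<integral>\<^sup>+l. indicator {j<..} (fst l) * ?g k (snd l j) \<partial>distr sampling level (\<lambda>q. q k))"
      using h by (intro nn_integral_distr[symmetric]) auto
    also have "distr sampling level (\<lambda>q. q k) = level"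
      unfolding sampling_def by (rule Q.PiM_component) simp
    also have "(\<integral>\<^sup>+l. indicator {j<..} (fst l) * ?g k (snd l j) \<partial>level)
        = (\<integral>\<^sup>+K. \<integral>\<^sup>+z. indicator {j<..} K * ?g k (z j) \<partial>PiM UNIV (\<lambda>_. \<rho>) \<partial>measure_pmf (poisson_pmf c))"
      using h unfolding level_def by (subst A.nn_integral_fst[symmetric]) simp_all
    also have "\<dots> = (\<integral>\<^sup>+K. indicator {j<..} K * (\<integral>\<^sup>+z. ?g k z \<partial>\<rho>) \<partial>measure_pmf (poisson_pmf c))"
    proof (rule nn_integral_cong)
      fix K
      have "(\<integral>\<^sup>+z. ?g k (z j) \<partial>PiM UNIV (\<lambda>_. \<rho>)) = (\<integral>\<^sup>+z. ?g k z \<partial>distr (PiM UNIV (\<lambda>_. \<rho>)) \<rho> (\<lambda>z. z j))"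
        by (rule nn_integral_distr[symmetric]) measurable
      also have "distr (PiM UNIV (\<lambda>_. \<rho>)) \<rho> (\<lambda>z. z j) = \<rho>" by (rule P.PiM_component) simp
      finally show "(\<integral>\<^sup>+z. indicator {j<..} K * ?g k (z j) \<partial>PiM UNIV (\<lambda>_. \<rho>)) = indicator {j<..} K * (\<integral>\<^sup>+z. ?g k z \<partial>\<rho>)"
        by (subst nn_integral_cmult) simp_all
    qed
    also have "\<dots> = emeasure (measure_pmf (poisson_pmf c)) {j<..} * (\<integral>\<^sup>+z. ?g k z \<partial>\<rho>)"
      by (subst nn_integral_multc) simp_all
    finally show ?thesis .
  qed
  have number: "(\<Sum>j. emeasure (measure_pmf (poisson_pmf c)) {j<..}) = ennreal c"
  proof -
    have "(\<Sum>j. emeasure (measure_pmf (poisson_pmf c)) {j<..}) = (\<Sum>j. \<integral>\<^sup>+K. indicator {..<K} j \<partial>measure_pmf (poisson_pmf c))"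
    proof (rule suminf_cong)
      fix j
      have "emeasure (measure_pmf (poisson_pmf c)) {j<..} = (\<integral>\<^sup>+K. indicator {j<..} K \<partial>measure_pmf (poisson_pmf c))"
        by simp
      also have "\<dots> = (\<integral>\<^sup>+K. indicator {..<K} j \<partial>measure_pmf (poisson_pmf c))"
        by (intro nn_integral_cong) (simp add: indicator_def)
      finally show "emeasure (measure_pmf (poisson_pmf c)) {j<..} = \<dots>" .
    qed
    also have "\<dots> = (\<integral>\<^sup>+K. (\<Sum>j. indicator {..<K} j) \<partial>measure_pmf (poisson_pmf c))"
      by (rule nn_integral_suminf[symmetric]) simp
    also have "\<dots> = ennreal c" by (simp add: ennreal_of_nat_eq_suminf poisson_mean[OF c_pos])
    finally show ?thesis .
  qed
  have "(\<integral>\<^sup>+i. \<integral>\<^sup>+q. (if active i q then g (point i q) else 0) \<partial>sampling \<partial>count_space UNIV)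
      = (\<Sum>k. \<Sum>j. \<integral>\<^sup>+q. (if active (k, j) q then g (point (k, j) q) else 0) \<partial>sampling)"
    by (subst nn_integral_fst_count_space[symmetric]) (simp add: nn_integral_count_space_nat)
  also have "\<dots> = (\<Sum>k. ennreal c * (\<integral>\<^sup>+z. ?g k z \<partial>\<rho>))"
    unfolding one by (simp add: number)
  also have "\<dots> = (\<integral>\<^sup>+z. g z \<partial>sampled)"
    by (simp add: nn_integral_sampled nn_integral_cmult)
  finally show ?thesis .
qed

text \<open>Two samples are independent with law \<open>\<rho>\<close>, whether they come from the same level or from different ones.\<close>

lemma AE_distinct_points:
  assumes R: "AE p in \<rho> \<Otimes>\<^sub>M \<rho>. R (fst p) (snd p)"
    and i: "i \<noteq> i'"
    and R_meas [measurable]: "Measurable.pred (\<rho> \<Otimes>\<^sub>M \<rho>) (\<lambda>p. R (fst p) (snd p))"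
  shows "AE q in sampling. R (point i q) (point i' q)"
proof -
  interpret A: prob_space "PiM UNIV (\<lambda>_::nat. \<rho>)" by (rule prob_space_PiM_\<rho>)
  interpret B: prob_space "measure_pmf (poisson_pmf c)" by (rule prob_space_measure_pmf)
  interpret L: prob_space level by (rule prob_space_level)
  interpret P: product_prob_space "\<lambda>_::nat. \<rho>" UNIV ..
  interpret LL: pair_prob_space level level ..
  interpret BA: pair_prob_space "measure_pmf (poisson_pmf c)" "PiM UNIV (\<lambda>_::nat. \<rho>)" ..
  have position: "distr level \<rho> (\<lambda>l. snd l j) = \<rho>" for j
  proof (rule measure_eqI)
    fix X assume "X \<in> sets (distr level \<rho> (\<lambda>l. snd l j))"
    then have X [measurable]: "X \<in> sets \<rho>" by simp
    have "emeasure (distr level \<rho> (\<lambda>l. snd l j)) X = emeasure level ((\<lambda>l. snd l j) -` X \<inter> space level)"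
      by (rule emeasure_distr) measurable
    also have "(\<lambda>l. snd l j) -` X \<inter> space level = UNIV \<times> {z \<in> space (PiM UNIV (\<lambda>_. \<rho>)). z j \<in> X}"
      by (auto simp: level_def space_pair_measure)
    also have "emeasure level \<dots> = emeasure (PiM UNIV (\<lambda>_. \<rho>)) {z \<in> space (PiM UNIV (\<lambda>_. \<rho>)). z j \<in> X}"
      unfolding level_def using measure_pmf.emeasure_space_1[of "poisson_pmf c"]
      by (subst A.emeasure_pair_measure_Times) simp_all
    also have "\<dots> = emeasure \<rho> X" by (rule P.emeasure_PiM_Collect_single) (use X in simp_all)
    finally show "emeasure (distr level \<rho> (\<lambda>l. snd l j)) X = emeasure \<rho> X" .
  qed simp
  obtain k j k' j' where ij: "i = (k, j)" "i' = (k', j')" by (cases i, cases i')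
  show ?thesis
  proof (cases "k = k'")
    case True
    then have "j \<noteq> j'" using i ij by auto
    have "AE z in PiM UNIV (\<lambda>_. \<rho>). R (z j) (z j')"
      by (rule AE_PiM_two_components[OF prob_space_axioms \<open>j \<noteq> j'\<close> _ _ R]) auto
    then have "AE l in level. R (snd l j) (snd l j')"
    proof -
      have "(\<lambda>l. (snd l j, snd l j')) \<in> level \<rightarrow>\<^sub>M \<rho> \<Otimes>\<^sub>M \<rho>" by measurable
      from measurable_compose[OF this R_meas]
      have "{l \<in> space level. R (snd l j) (snd l j')} \<in> sets level" by (simp add: pred_def)
      then show ?thesis
        using \<open>AE z in PiM UNIV (\<lambda>_. \<rho>). R (z j) (z j')\<close>
        unfolding level_def by (intro BA.AE_pair_measure) auto
    qed
    then show ?thesis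
      unfolding sampling_def point_def ij True fst_conv snd_conv
      by (intro AE_PiM_component[of UNIV "\<lambda>_. level"] prob_space_level) auto
  next
    case False
    have [measurable]: "(\<lambda>l. snd (fst l) a) \<in> level \<Otimes>\<^sub>M level \<rightarrow>\<^sub>M \<rho>" for a
      by (rule measurable_compose[OF measurable_fst measurable_position])
    have [measurable]: "(\<lambda>l. snd (snd l) a) \<in> level \<Otimes>\<^sub>M level \<rightarrow>\<^sub>M \<rho>" for a
      by (rule measurable_compose[OF measurable_snd measurable_position])
    have "AE p in distr (level \<Otimes>\<^sub>M level) (\<rho> \<Otimes>\<^sub>M \<rho>) (\<lambda>(l, l'). (snd l j, snd l' j')). R (fst p) (snd p)"
    proof -
      have "distr (level \<Otimes>\<^sub>M level) (\<rho> \<Otimes>\<^sub>M \<rho>) (\<lambda>(l, l'). (snd l j, snd l' j')) = \<rho> \<Otimes>\<^sub>M \<rho>"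
        by (subst pair_measure_distr[symmetric]) (simp_all add: position sigma_finite_measure_axioms)
      then show ?thesis using R by (simp only:)
    qed
    then have "AE l in level \<Otimes>\<^sub>M level. R (snd (fst l) j) (snd (snd l) j')"
      by (rule AE_distrD[rotated, THEN eventually_mono]) (auto simp: split_def)
    then show ?thesis
      unfolding sampling_def point_def ij fst_conv snd_conv
      by (intro AE_PiM_two_components[OF prob_space_level False]) auto
  qed
qed

lemma measure_level_void:
  assumes [measurable]: "E \<in> sets \<rho>"
  shows "measure level {l \<in> space level. \<forall>j<fst l. snd l j \<notin> E} = exp (- (c * measure \<rho> E))"
proof -
  interpret A: prob_space "PiM UNIV (\<lambda>_::nat. \<rho>)" by (rule prob_space_PiM_\<rho>)
  interpret L: prob_space level by (rule prob_space_level)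
  interpret P: product_prob_space "\<lambda>_::nat. \<rho>" UNIV ..
  have meas: "{l \<in> space level. \<forall>j<fst l. snd l j \<notin> E} \<in> sets level" by measurable
  have "emeasure level {l \<in> space level. \<forall>j<fst l. snd l j \<notin> E}
      = (\<integral>\<^sup>+K. emeasure (PiM UNIV (\<lambda>_. \<rho>)) (Pair K -` {l \<in> space level. \<forall>j<fst l. snd l j \<notin> E}) \<partial>measure_pmf (poisson_pmf c))"
    using meas unfolding level_def by (rule A.emeasure_pair_measure_alt)
  also have "\<dots> = (\<integral>\<^sup>+K. ennreal (1 - measure \<rho> E) ^ K \<partial>measure_pmf (poisson_pmf c))"
  proof (rule nn_integral_cong)
    fix K
    have "Pair K -` {l \<in> space level. \<forall>j<fst l. snd l j \<notin> E}
        = {z \<in> space (PiM UNIV (\<lambda>_. \<rho>)). \<forall>j\<in>{..<K}. z j \<in> space \<rho> - E}"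
      by (auto simp: level_def space_pair_measure space_PiM)
    also have "emeasure (PiM UNIV (\<lambda>_. \<rho>)) \<dots> = (\<Prod>j<K. emeasure \<rho> (space \<rho> - E))"
      by (rule P.emeasure_PiM_Collect) auto
    also have "\<dots> = ennreal (1 - measure \<rho> E) ^ K"
      using prob_compl[of E] by (simp add: emeasure_eq_measure)
    finally show "emeasure (PiM UNIV (\<lambda>_. \<rho>)) (Pair K -` {l \<in> space level. \<forall>j<fst l. snd l j \<notin> E})
      = ennreal (1 - measure \<rho> E) ^ K" .
  qed
  also have "\<dots> = ennreal (exp (- (c * measure \<rho> E)))"
    using c_pos by (subst poisson_power_series) (auto simp: prob_le_1)
  finally show ?thesis by (simp add: L.emeasure_eq_measure)
qed

lemma void_event [measurable]:
  assumes [measurable]: "E \<in> sets \<rho>"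
  shows "{q \<in> space sampling. \<forall>i. active i q \<longrightarrow> point i q \<notin> E} \<in> sets sampling"
  by measurable

text \<open>The levels are independent, and level \<open>k\<close> avoids \<open>E\<close> with probability \<open>exp (- a k)\<close>, where the \<open>a k\<close> sum to the
measure of \<open>E\<close>.\<close>

lemma void_probability:
  assumes E [measurable]: "E \<in> sets \<rho>"
  shows "measure sampling {q \<in> space sampling. \<forall>i. active i q \<longrightarrow> point i q \<notin> E}
    = (if emeasure sampled E = \<infinity> then 0 else exp (- enn2real (emeasure sampled E)))"
proof -
  interpret L: prob_space level by (rule prob_space_level)
  interpret S: sequence_space level ..
  define a where "a k = c * measure \<rho> {z \<in> E. k < m z}" for k
  have E_space: "E \<subseteq> space \<rho>" using E by (rule sets.sets_into_space)
  have Ek: "{z \<in> E. k < m z} \<in> sets \<rho>" for k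
  proof -
    have "{z \<in> E. k < m z} = E \<inter> {z \<in> space \<rho>. k < m z}" using E_space by auto
    then show ?thesis by simp
  qed
  have a0: "0 \<le> a k" for k using c_pos by (simp add: a_def)
  have total: "emeasure sampled E = (\<Sum>k. ennreal (a k))"
  proof -
    have "emeasure sampled E = (\<integral>\<^sup>+z. indicator E z \<partial>sampled)"
      by (simp add: sampled_def)
    also have "\<dots> = (\<Sum>k. \<integral>\<^sup>+z. ennreal c * indicator {z \<in> E. k < m z} z \<partial>\<rho>)"
      by (subst nn_integral_sampled) (auto intro!: suminf_cong nn_integral_cong simp: indicator_def)
    also have "\<dots> = (\<Sum>k. ennreal (a k))"
      using Ek c_pos by (intro suminf_cong) (simp add: nn_integral_cmult_indicator a_def emeasure_eq_measure ennreal_mult)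
    finally show ?thesis .
  qed
  define V where "V k = {l \<in> space level. \<forall>j<fst l. snd l j \<notin> {z \<in> E. k < m z}}" for k
  have "V k \<in> sets level" for k unfolding V_def using Ek[of k] by measurable
  then have "(\<lambda>n. \<Prod>k\<le>n. measure level (V k)) \<longlonglongrightarrow> measure sampling (Pi UNIV V)"
    unfolding sampling_def by (rule S.measure_PiM_countable)
  moreover have "measure level (V k) = exp (- a k)" for k
    unfolding V_def a_def by (rule measure_level_void[OF Ek])
  moreover have "Pi UNIV V = {q \<in> space sampling. \<forall>i. active i q \<longrightarrow> point i q \<notin> E}"
  proof -
    have "q \<in> space sampling \<longleftrightarrow> (\<forall>k. q k \<in> space level)" for q
      by (simp add: sampling_def space_PiM PiE_iff)
    then show ?thesis by (auto simp: V_def active_def point_def Pi_iff)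
  qed
  ultimately have lim: "(\<lambda>n. exp (- (\<Sum>k\<le>n. a k)))
      \<longlonglongrightarrow> measure sampling {q \<in> space sampling. \<forall>i. active i q \<longrightarrow> point i q \<notin> E}"
    by (simp add: exp_sum[symmetric] sum_negf)
  show ?thesis
  proof (cases "emeasure sampled E = \<infinity>")
    case True
    have "(\<lambda>n. \<Sum>k\<le>n. ennreal (a k)) \<longlonglongrightarrow> top"
      using True total summable_LIMSEQ'[of "\<lambda>k. ennreal (a k)"] by simp
    then have "filterlim (\<lambda>n. \<Sum>k\<le>n. a k) at_top sequentially"
      using a0 by (simp add: sum_ennreal ennreal_tendsto_top_eq_at_top)
    then have "filterlim (\<lambda>n. - (\<Sum>k\<le>n. a k)) at_bot sequentially"
      by (rule filterlim_uminus_at_top[THEN iffD1])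
    then have "(\<lambda>n. exp (- (\<Sum>k\<le>n. a k))) \<longlonglongrightarrow> 0"
      by (rule filterlim_compose[OF exp_at_bot])
    then show ?thesis using LIMSEQ_unique[OF lim] True by simp
  next
    case False
    then have "summable a" using total a0 by (intro summable_suminf_not_top) auto
    then have "(\<lambda>n. exp (- (\<Sum>k\<le>n. a k))) \<longlonglongrightarrow> exp (- suminf a)"
      by (intro tendsto_intros summable_LIMSEQ')
    moreover have "enn2real (emeasure sampled E) = suminf a"
      using total \<open>summable a\<close> a0 by (simp add: suminf_ennreal2 suminf_nonneg)
    ultimately show ?thesis using LIMSEQ_unique[OF lim] False by simp
  qed
qed

end

text \<open>Divide \<open>M\<close> by an integer-valued function \<open>m\<close> that is large enough to make it finite, and normalize.\<close>

lemma (in sigma_finite_measure) obtain_poisson_sampling: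
  assumes "emeasure M (space M) \<noteq> 0"
  obtains \<rho> c m where "poisson_sampling \<rho> c m" "sets \<rho> = sets M" "absolutely_continuous M \<rho>"
    "poisson_sampling.sampled \<rho> c m = M"
proof -
  obtain h where h [measurable]: "h \<in> borel_measurable M" and finite_sets: "integral\<^sup>N M h \<noteq> \<infinity>"
      and pos: "\<And>x. x \<in> space M \<Longrightarrow> 0 < h x \<and> h x < \<infinity>"
    using Ex_finite_integrable_function by metis
  \<comment> \<open>\<open>1 / m\<close> is at most the integrable function \<open>h\<close>\<close>
  define m where "m x = nat \<lceil>1 / enn2real (h x)\<rceil>" for x
  have m_pos: "0 < m x" and m_h: "1 / real (m x) \<le> enn2real (h x)" if "x \<in> space M" for x
  proof -
    have "0 < enn2real (h x)" using pos[OF that] by (simp add: enn2real_positive_iff)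
    then have "1 / enn2real (h x) \<le> real (m x)" and "0 < 1 / enn2real (h x)"
      unfolding m_def by (simp_all add: real_nat_ceiling_ge)
    then show "0 < m x" "1 / real (m x) \<le> enn2real (h x)"
      using \<open>0 < enn2real (h x)\<close> by (auto simp: divide_le_eq field_simps intro!: gr0I)
  qed
  have [measurable]: "m \<in> M \<rightarrow>\<^sub>M count_space UNIV" unfolding m_def by measurable
  define I where "I = (\<integral>\<^sup>+x. ennreal (1 / real (m x)) \<partial>M)"
  have "I \<le> integral\<^sup>N M h"
    unfolding I_def
  proof (rule nn_integral_mono)
    fix x assume x: "x \<in> space M"
    then show "ennreal (1 / real (m x)) \<le> h x"
      using m_h[OF x] pos[OF x] by (metis ennreal_enn2real ennreal_leI infinity_ennreal_def)
  qed
  then have "I < \<infinity>" using finite_sets by (auto simp: less_top[symmetric] top_unique)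
  have "I \<noteq> 0"
  proof
    assume "I = 0"
    then have "emeasure M {x \<in> space M. ennreal (1 / real (m x)) \<noteq> 0} = 0"
      unfolding I_def by (subst (asm) nn_integral_0_iff) auto
    moreover have "{x \<in> space M. ennreal (1 / real (m x)) \<noteq> 0} = space M"
      using m_pos by auto
    ultimately show False using assms by simp
  qed
  define c where "c = enn2real I"
  have c: "0 < c" "I = ennreal c" using \<open>I < \<infinity>\<close> \<open>I \<noteq> 0\<close> by (auto simp: c_def enn2real_positive_iff zero_less_iff_neq_zero)
  define \<rho> where "\<rho> = density M (\<lambda>x. ennreal (1 / (c * real (m x))))"
  have "emeasure \<rho> (space \<rho>) = (\<integral>\<^sup>+x. ennreal (1 / c) * ennreal (1 / real (m x)) \<partial>M)"
    unfolding \<rho>_def using c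
    by (simp add: emeasure_density ennreal_mult[symmetric] cong: nn_integral_cong)
  also have "\<dots> = ennreal (1 / c) * ennreal c"
    by (subst nn_integral_cmult) (simp_all add: I_def[symmetric] c)
  also have "\<dots> = 1" using c by (simp add: ennreal_mult[symmetric])
  finally have "prob_space \<rho>" by (rule prob_spaceI)
  have sets_\<rho> [measurable_cong]: "sets \<rho> = sets M" by (simp add: \<rho>_def)
  have ps: "poisson_sampling \<rho> c m"
    using \<open>prob_space \<rho>\<close> c by (simp add: poisson_sampling_def poisson_sampling_axioms_def)
  have "poisson_sampling.sampled \<rho> c m = M"
    unfolding poisson_sampling.sampled_def[OF ps] unfolding \<rho>_def
  proof (subst density_density_eq)
    have "density M (\<lambda>x. ennreal (1 / (c * real (m x))) * (ennreal c * of_nat (m x))) = density M (\<lambda>_. 1)"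
    proof (rule density_cong)
      show "AE x in M. ennreal (1 / (c * real (m x))) * (ennreal c * of_nat (m x)) = 1"
        using m_pos c(1) by (intro AE_I2) (simp add: ennreal_of_nat_eq_real_of_nat ennreal_mult[symmetric])
    qed measurable
    then show "density M (\<lambda>x. ennreal (1 / (c * real (m x))) * (ennreal c * of_nat (m x))) = M"
      by (simp add: density_1)
  qed measurable
  moreover have "absolutely_continuous M \<rho>"
    unfolding \<rho>_def by (rule absolutely_continuousI_density) measurable
  ultimately show ?thesis using that[OF ps sets_\<rho>] by blast
qed

section \<open>Configurations and the algebra of void events\<close>

definition counting :: "'a::metric_space set \<Rightarrow> 'a measure" where
  "counting C = distr (count_space C) borel (\<lambda>x. x)"

lemma sets_counting [simp]: "sets (counting C) = sets borel"
  by (simp add: counting_def)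

lemma emeasure_counting:
  assumes "A \<in> sets borel"
  shows "emeasure (counting C) A = emeasure (count_space UNIV) (C \<inter> A)"
proof -
  have "emeasure (counting C) A = emeasure (count_space C) (A \<inter> C)"
    unfolding counting_def using assms by (subst emeasure_distr) auto
  then show ?thesis by (simp add: emeasure_count_space Int_commute)
qed

lemma counting_in_point_configurations:
  fixes C :: "'a::metric_space set"
  assumes "\<And>r::nat. finite (C \<inter> ball a r)"
  shows "counting C \<in> point_configurations"
proof -
  have bounded: "finite (C \<inter> A)" if A: "bounded A" for A
  proof -
    obtain r where "A \<subseteq> ball a r" using bounded_subset_ballD[OF A, of a] by blast
    moreover obtain n :: nat where "r \<le> n" using real_arch_simple by blast
    ultimately have "C \<inter> A \<subseteq> C \<inter> ball a n" by (auto simp: subset_iff)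
    then show ?thesis using assms finite_subset by blast
  qed
  have "countable (\<Union>r::nat. C \<inter> ball a r)"
    using assms by (intro countable_UN) (auto intro: countable_finite)
  also have "(\<Union>r::nat. C \<inter> ball a r) = C"
    by (auto simp: reals_Archimedean2)
  finally have "countable C" .
  moreover have "emeasure (counting C) A = (\<integral>\<^sup>+x. emeasure (return borel x) A \<partial>count_space C)"
    if "A \<in> sets borel" for A
  proof -
    have "(\<integral>\<^sup>+x. emeasure (return borel x) A \<partial>count_space C) = (\<integral>\<^sup>+x. indicator (C \<inter> A) x \<partial>count_space C)"
      using that by (intro nn_integral_cong) (simp add: indicator_def)
    also have "\<dots> = emeasure (count_space C) (C \<inter> A)" by simp
    finally show ?thesis using that by (simp add: emeasure_counting emeasure_count_space)
  qed
  moreover have "boundedly_finite (counting C)"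
    unfolding boundedly_finite_def
    by (auto simp: emeasure_counting emeasure_count_space bounded of_nat_less_top)
  ultimately have "\<exists>C'. countable C' \<and> (\<forall>A\<in>sets borel.
      emeasure (counting C) A = (\<integral>\<^sup>+x. emeasure (return borel x) A \<partial>count_space C'))"
    "boundedly_finite (counting C)"
    by blast+
  then show ?thesis unfolding point_configurations_def by simp
qed

lemma measurable_configuration_algebra:
  assumes "\<And>\<omega>. \<omega> \<in> space P \<Longrightarrow> N \<omega> \<in> point_configurations"
    and "\<And>A. A \<in> sets borel \<Longrightarrow> (\<lambda>\<omega>. emeasure (N \<omega>) A) \<in> borel_measurable P"
  shows "N \<in> P \<rightarrow>\<^sub>M configuration_algebra"
  unfolding configuration_algebra_def
proof (rule measurable_SUP2)
  show "{A \<in> sets borel. bounded A} \<noteq> {}" by auto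
qed (use assms in \<open>auto intro!: measurable_vimage_algebra2\<close>)

definition void_algebra :: "'a::topological_space set set \<Rightarrow> 'a set measure" where
  "void_algebra H = sigma H {{C \<in> H. C \<inter> A = {}} | A. A \<in> sets borel}"

lemma space_void_algebra [simp]: "space (void_algebra H) = H"
  unfolding void_algebra_def by (rule space_measure_of) auto

lemma sets_void_algebra:
  "sets (void_algebra H) = sigma_sets H {{C \<in> H. C \<inter> A = {}} | A. A \<in> sets borel}"
  unfolding void_algebra_def by (rule sets_measure_of) auto

lemma void_event_sets: "A \<in> sets borel \<Longrightarrow> {C \<in> H. C \<inter> A = {}} \<in> sets (void_algebra H)"
  unfolding sets_void_algebra by (rule sigma_sets.Basic) auto

lemma measurable_void_algebraI:
  assumes "\<And>\<omega>. \<omega> \<in> space Q \<Longrightarrow> Z \<omega> \<in> H"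
    and "\<And>A. A \<in> sets borel \<Longrightarrow> {\<omega> \<in> space Q. Z \<omega> \<inter> A = {}} \<in> sets Q"
  shows "Z \<in> Q \<rightarrow>\<^sub>M void_algebra H"
  unfolding void_algebra_def
proof (rule measurable_measure_of)
  fix Y assume "Y \<in> {{C \<in> H. C \<inter> A = {}} | A. A \<in> sets borel}"
  then obtain A where A: "A \<in> sets borel" "Y = {C \<in> H. C \<inter> A = {}}" by auto
  have "Z -` Y \<inter> space Q = {\<omega> \<in> space Q. Z \<omega> \<inter> A = {}}" using assms(1) A by auto
  then show "Z -` Y \<inter> space Q \<in> sets Q" using assms(2) A by simp
qed (use assms in auto)

lemma void_algebra_measure_eqI:
  assumes P: "finite_measure P" "sets P = sets (void_algebra H)" "sets P' = sets (void_algebra H)"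
    and eq: "\<And>A. A \<in> sets borel \<Longrightarrow> emeasure P {C \<in> H. C \<inter> A = {}} = emeasure P' {C \<in> H. C \<inter> A = {}}"
  shows "P = P'"
proof (rule measure_eqI_generator_eq[where A="\<lambda>_. H"])
  interpret finite_measure P by fact
  let ?E = "{{C \<in> H. C \<inter> A = {}} | A. A \<in> sets (borel :: 'a measure)}"
  show "Int_stable ?E"
  proof (rule Int_stableI)
    fix X Y assume "X \<in> ?E" "Y \<in> ?E"
    then obtain A B where AB: "A \<in> sets borel" "B \<in> sets borel"
      "X = {C \<in> H. C \<inter> A = {}}" "Y = {C \<in> H. C \<inter> B = {}}" by auto
    then have "X \<inter> Y = {C \<in> H. C \<inter> (A \<union> B) = {}}" by auto
    then show "X \<inter> Y \<in> ?E" using AB by blast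
  qed
  show "range (\<lambda>_. H) \<subseteq> ?E" by (auto intro!: exI[of _ "{}"])
  show "emeasure P X = emeasure P' X" if "X \<in> ?E" for X using that eq by auto
  show "emeasure P H \<noteq> \<infinity>" by simp
qed (use P in \<open>auto simp: sets_void_algebra\<close>)

lemma disjoint_basic_neighbourhoods:
  fixes F :: "'a::metric_space set"
  assumes B: "topological_basis B" and F: "finite F"
  obtains b where "\<And>x. x \<in> F \<Longrightarrow> b x \<in> B" "\<And>x. x \<in> F \<Longrightarrow> x \<in> b x"
    "\<And>x y. x \<in> F \<Longrightarrow> y \<in> F \<Longrightarrow> x \<noteq> y \<Longrightarrow> b x \<inter> b y = {}"
proof -
  define D where "D = insert 1 ((\<lambda>(x, y). dist x y) ` {p \<in> F \<times> F. fst p \<noteq> snd p})"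
  \<comment> \<open>the element \<open>1\<close> keeps \<open>D\<close> nonempty when \<open>F\<close> has fewer than two points\<close>
  define r where "r = Min D / 2"
  have D: "finite D" "D \<noteq> {}" using F unfolding D_def by auto
  have "0 < Min D" using D by (subst Min_gr_iff) (auto simp: D_def)
  then have "0 < r" by (simp add: r_def)
  have far: "2 * r \<le> dist x y" if "x \<in> F" "y \<in> F" "x \<noteq> y" for x y
    using D that by (auto simp: r_def D_def intro!: Min_le)
  have "\<exists>U\<in>B. x \<in> U \<and> U \<subseteq> ball x r" for x
    using topological_basisE[OF B, of "ball x r" x] \<open>0 < r\<close> by (metis centre_in_ball open_ball)
  then obtain b where b: "\<And>x. b x \<in> B" "\<And>x. x \<in> b x" "\<And>x. b x \<subseteq> ball x r" by metis
  have "b x \<inter> b y = {}" if xy: "x \<in> F" "y \<in> F" "x \<noteq> y" for x y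
  proof (rule ccontr)
    assume "b x \<inter> b y \<noteq> {}"
    then obtain z where "dist x z < r" "dist y z < r" using b(3) by (auto simp: subset_iff)
    then show False using far[OF xy] dist_triangle2[of x y z] by linarith
  qed
  then show ?thesis using that[of b] b(1,2) by simp
qed

text \<open>At least \<open>n\<close> points of \<open>C\<close> lie in \<open>A\<close> if and only if \<open>C \<inter> A\<close> meets each of some \<open>n\<close> disjoint members of a countable
basis; these are countably many choices.\<close>

lemma measurable_at_least_points:
  fixes A :: "'a::{metric_space, second_countable_topology} set"
  assumes A: "A \<in> sets borel"
  shows "{C \<in> H. \<exists>F \<subseteq> C \<inter> A. finite F \<and> card F = n} \<in> sets (void_algebra H)"
proof -
  obtain B :: "'a set set" where B: "countable B" "topological_basis B"
    using ex_countable_basis by blast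
  define \<U> where "\<U> = {U. U \<subseteq> B \<and> finite U \<and> card U = n \<and> disjoint U}"
  have "countable \<U>"
    using countable_Collect_finite_subset[OF B(1)] by (rule countable_subset[rotated]) (auto simp: \<U>_def)
  have eq: "{C \<in> H. \<exists>F \<subseteq> C \<inter> A. finite F \<and> card F = n}
    = (\<Union>U\<in>\<U>. {C \<in> H. \<forall>u\<in>U. C \<inter> (A \<inter> u) \<noteq> {}})" (is "?L = ?R")
  proof
    show "?L \<subseteq> ?R"
    proof
      fix C assume "C \<in> ?L"
      then obtain F where F: "C \<in> H" "F \<subseteq> C \<inter> A" "finite F" "card F = n" by auto
      obtain b where b: "\<And>x. x \<in> F \<Longrightarrow> b x \<in> B" "\<And>x. x \<in> F \<Longrightarrow> x \<in> b x"
        "\<And>x y. x \<in> F \<Longrightarrow> y \<in> F \<Longrightarrow> x \<noteq> y \<Longrightarrow> b x \<inter> b y = {}"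
        using disjoint_basic_neighbourhoods[OF B(2) F(3)] by metis
      have "inj_on b F" using b by (intro inj_onI) blast
      then have "b ` F \<in> \<U>"
      proof -
        have "disjoint (b ` F)"
        proof (rule disjointI)
          fix X Y assume "X \<in> b ` F" "Y \<in> b ` F" "X \<noteq> Y"
          then obtain x y where "X = b x" "Y = b y" "x \<in> F" "y \<in> F" "x \<noteq> y" by auto
          then show "X \<inter> Y = {}" using b(3) by simp
        qed
        then show ?thesis using b F \<open>inj_on b F\<close> by (auto simp: \<U>_def card_image)
      qed
      moreover have "\<forall>u\<in>b ` F. C \<inter> (A \<inter> u) \<noteq> {}" using b F by auto
      ultimately show "C \<in> ?R" using F by blast
    qed
    show "?R \<subseteq> ?L"
    proof
      fix C assume "C \<in> ?R"
      then obtain U where U: "U \<in> \<U>" "C \<in> H" "\<forall>u\<in>U. \<exists>x. x \<in> C \<inter> (A \<inter> u)" by blast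
      then obtain x where x: "\<And>u. u \<in> U \<Longrightarrow> x u \<in> C \<inter> (A \<inter> u)" by metis
      have "inj_on x U"
      proof (rule inj_onI)
        fix u v assume "u \<in> U" "v \<in> U" "x u = x v"
        then have "x u \<in> u \<inter> v" using x by fastforce
        then show "u = v" using U \<open>u \<in> U\<close> \<open>v \<in> U\<close> unfolding \<U>_def disjoint_def by blast
      qed
      then show "C \<in> ?L"
        using U x by (auto simp: \<U>_def card_image intro!: exI[of _ "x ` U"])
    qed
  qed
  have "{C \<in> H. \<forall>u\<in>U. C \<inter> (A \<inter> u) \<noteq> {}} \<in> sets (void_algebra H)" if "U \<in> \<U>" for U
  proof -
    have void: "{C \<in> H. C \<inter> (A \<inter> u) = {}} \<in> sets (void_algebra H)" if "u \<in> U" for u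
      using that \<open>U \<in> \<U>\<close> topological_basis_open[OF B(2)] A
      by (intro void_event_sets) (auto simp: \<U>_def)
    have "finite U" using \<open>U \<in> \<U>\<close> by (simp add: \<U>_def)
    moreover have "H \<in> sets (void_algebra H)" using sets.top[of "void_algebra H"] by simp
    ultimately have "H - (\<Union>u\<in>U. {C \<in> H. C \<inter> (A \<inter> u) = {}}) \<in> sets (void_algebra H)"
      using void by (intro sets.Diff sets.finite_UN)
    also have "H - (\<Union>u\<in>U. {C \<in> H. C \<inter> (A \<inter> u) = {}}) = {C \<in> H. \<forall>u\<in>U. C \<inter> (A \<inter> u) \<noteq> {}}"
      by auto
    finally show ?thesis .
  qed
  then have "(\<lambda>U. {C \<in> H. \<forall>u\<in>U. C \<inter> (A \<inter> u) \<noteq> {}}) ` \<U> \<subseteq> sets (void_algebra H)"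
    by (rule image_subsetI)
  with \<open>countable \<U>\<close> show ?thesis unfolding eq by (rule sets.countable_UN')
qed

lemma measurable_card_Int:
  fixes A :: "'a::{metric_space, second_countable_topology} set"
  assumes A: "A \<in> sets borel"
  shows "(\<lambda>C. emeasure (count_space UNIV) (C \<inter> A)) \<in> borel_measurable (void_algebra H)"
proof -
  let ?L = "\<lambda>m. {C \<in> H. \<exists>F \<subseteq> C \<inter> A. finite F \<and> card F = Suc m}"
  have eq: "emeasure (count_space UNIV) (C \<inter> A) = (\<Sum>m. indicator (?L m) C)" if "C \<in> H" for C
  proof (cases "finite (C \<inter> A)")
    case True
    have "indicator (?L m) C = (indicator {..<card (C \<inter> A)} m :: ennreal)" for m
    proof -
      have "(\<exists>F \<subseteq> C \<inter> A. finite F \<and> card F = Suc m) \<longleftrightarrow> Suc m \<le> card (C \<inter> A)"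
      proof
        assume "\<exists>F \<subseteq> C \<inter> A. finite F \<and> card F = Suc m"
        then obtain F where "F \<subseteq> C \<inter> A" "card F = Suc m" by blast
        then show "Suc m \<le> card (C \<inter> A)" using card_mono[OF True, of F] by simp
      next
        assume "Suc m \<le> card (C \<inter> A)"
        then obtain F where "F \<subseteq> C \<inter> A" "card F = Suc m" "finite F"
          by (rule obtain_subset_with_card_n)
        then show "\<exists>F \<subseteq> C \<inter> A. finite F \<and> card F = Suc m" by (intro exI[of _ F] conjI)
      qed
      then show ?thesis using that by (simp add: indicator_def Suc_le_eq)
    qed
    then have "(\<Sum>m. indicator (?L m) C) = (\<Sum>m. indicator {..<card (C \<inter> A)} m :: ennreal)" by (simp only:)
    also have "\<dots> = of_nat (card (C \<inter> A))" by (subst suminf_finite[of "{..<card (C \<inter> A)}"]) auto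
    finally have "(\<Sum>m. indicator (?L m) C) = (of_nat (card (C \<inter> A)) :: ennreal)" .
    moreover have "emeasure (count_space UNIV) (C \<inter> A) = of_nat (card (C \<inter> A))" using True by simp
    ultimately show ?thesis by (simp only:)
  next
    case False
    have "C \<in> ?L m" for m
      using infinite_arbitrarily_large[OF False, of "Suc m"] that by blast
    then have "indicator (?L m) C = (1 :: ennreal)" for m by (rule indicator_eq_1_iff[THEN iffD2])
    then have "(\<Sum>m. indicator (?L m) C) = (\<Sum>m::nat. 1 :: ennreal)" by (simp only:)
    also have "\<dots> = \<infinity>"
      by (simp add: nn_integral_count_space_nat[symmetric] emeasure_count_space)
    finally have "(\<Sum>m. indicator (?L m) C) = (\<infinity> :: ennreal)" .
    moreover have "emeasure (count_space UNIV) (C \<inter> A) = \<infinity>" using False by simp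
    ultimately show ?thesis by (simp only:)
  qed
  have "(\<lambda>C. \<Sum>m. indicator (?L m) C :: ennreal) \<in> borel_measurable (void_algebra H)"
    by (intro borel_measurable_suminf_order borel_measurable_indicator measurable_at_least_points A)
  then show ?thesis
  proof (rule measurable_cong[THEN iffD2, rotated])
    fix C assume "C \<in> space (void_algebra H)"
    then have "C \<in> H" by simp
    then show "emeasure (count_space UNIV) (C \<inter> A) = (\<Sum>m. indicator (?L m) C)" by (rule eq)
  qed
qed

section \<open>Clusters\<close>

context infinite_system
begin

lemma aperiodic_iter: "aperiodic T (iter k x) \<longleftrightarrow> aperiodic T x"
proof -
  have "inj (\<lambda>j. iter (j + k) x) \<longleftrightarrow> inj (\<lambda>j. iter j x)"
  proof
    assume *: "inj (\<lambda>j. iter (j + k) x)"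
    show "inj (\<lambda>j. iter j x)"
    proof (rule injI)
      fix a b assume "iter a x = iter b x"
      then have "iter ((a - k) + k) x = iter ((b - k) + k) x" by simp
      with * have "a - k = b - k" by (rule injD)
      then show "a = b" by simp
    qed
  next
    assume *: "inj (\<lambda>j. iter j x)"
    show "inj (\<lambda>j. iter (j + k) x)"
      by (rule injI) (use injD[OF *] in fastforce)
  qed
  then show ?thesis by (simp add: aperiodic_def int_iterate_add[OF bij_T])
qed

lemma iter_1: "iter 1 x = T x"
  by (simp add: int_iterate_def)

text \<open>These sets form the sample space, so that every sample point has the required property of the orbits;
among arbitrary sets this property need not be an event. The family is invariant under \<open>T\<close>.\<close>

definition recurrent_sets :: "'a set set" where
  "recurrent_sets = {C. \<forall>x\<in>C. infinite (C \<inter> range (\<lambda>k. iter k x))}"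

lemma range_iter_T: "range (\<lambda>k. iter k (T x)) = range (\<lambda>k. iter k x)"
proof -
  have "range (\<lambda>k. iter k (T x)) = range (\<lambda>k. iter (k + 1) x)"
    by (simp only: int_iterate_add[OF bij_T] iter_1)
  also have "\<dots> = (\<lambda>k. iter k x) ` range (\<lambda>k. k + 1)" by (simp only: image_image)
  also have "range (\<lambda>k::int. k + 1) = UNIV" by (auto intro!: range_eqI[of _ _ "_ - 1"])
  finally show ?thesis .
qed

lemma image_T_orbit: "T ` range (\<lambda>k. iter k x) = range (\<lambda>k. iter k x)"
  using range_iter_T[of x] by (simp add: image_image int_iterate_T[OF bij_T, symmetric])

lemma image_T_recurrent_iff: "T ` C \<in> recurrent_sets \<longleftrightarrow> C \<in> recurrent_sets"
proof -
  have "finite (T ` C \<inter> range (\<lambda>k. iter k (T x))) \<longleftrightarrow> finite (C \<inter> range (\<lambda>k. iter k x))" for x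
  proof -
    have "T ` C \<inter> range (\<lambda>k. iter k (T x)) = T ` (C \<inter> range (\<lambda>k. iter k x))"
      using bij_T image_T_orbit[of x] by (simp add: range_iter_T image_Int[OF bij_is_inj])
    then show ?thesis using bij_T by (simp add: finite_image_iff bij_is_inj inj_on_subset[of T UNIV])
  qed
  then show ?thesis by (simp add: recurrent_sets_def)
qed

end

context cluster_system
begin

lemma space_marked [simp]: "space marked = UNIV"
  by (simp add: space_pair_measure)

text \<open>Marked points with periodic position, a null set, get an empty cluster; this makes every union of
clusters recurrent without exception.\<close>

definition cluster :: "'a \<times> (nat \<Rightarrow> bool) \<Rightarrow> 'a set" where
  "cluster z = (if aperiodic T (fst z) then (\<lambda>F. fst (act F z)) ` {F. finite F} else {})"

lemma inj_on_cluster: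
  assumes "aperiodic T (fst z)"
  shows "inj_on (\<lambda>F. fst (act F z)) {F. finite F}"
proof (rule inj_onI)
  fix F G assume FG: "F \<in> {F. finite F}" "G \<in> {F. finite F}" "fst (act F z) = fst (act G z)"
  then have "displacement n F (snd z) = displacement n G (snd z)"
    using assms unfolding aperiodic_def act_def by (auto dest: injD)
  then show "F = G" using FG displacement_inj by simp
qed

lemma infinite_cluster:
  assumes "aperiodic T (fst z)"
  shows "infinite (cluster z)"
proof -
  have "infinite ((\<lambda>i. {i}) ` (UNIV :: nat set))"
    by (subst finite_image_iff) (auto intro: inj_onI)
  then have "infinite {F :: nat set. finite F}" by (rule infinite_super[rotated]) auto
  then show ?thesis using assms inj_on_cluster[OF assms] by (simp add: cluster_def finite_image_iff)
qed

lemma cluster_subset_orbit: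
  assumes "x \<in> cluster z"
  shows "cluster z \<subseteq> range (\<lambda>k. iter k x)"
proof
  fix y assume "y \<in> cluster z"
  then obtain a b where "x = iter a (fst z)" "y = iter b (fst z)"
    using assms by (auto simp: cluster_def act_def split: if_splits)
  then have "y = iter (b - a) x"
    using int_iterate_add[OF bij_T, of "b - a" a "fst z"] by simp
  then show "y \<in> range (\<lambda>k. iter k x)" by auto
qed

lemma Union_clusters_recurrent: "(\<Union>i\<in>I. cluster (p i)) \<in> recurrent_sets"
  unfolding recurrent_sets_def
proof (intro CollectI ballI)
  fix x assume "x \<in> (\<Union>i\<in>I. cluster (p i))"
  then obtain i where i: "i \<in> I" "x \<in> cluster (p i)" by auto
  then have "infinite (cluster (p i))" using infinite_cluster by (metis cluster_def empty_iff)
  moreover have "cluster (p i) \<subseteq> (\<Union>i\<in>I. cluster (p i)) \<inter> range (\<lambda>k. iter k x)"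
    using i cluster_subset_orbit by auto
  ultimately show "infinite ((\<Union>i\<in>I. cluster (p i)) \<inter> range (\<lambda>k. iter k x))"
    using finite_subset by blast
qed

lemma cluster_act:
  assumes "finite G"
  shows "cluster (act G z) = cluster z"
proof -
  have "(\<lambda>F. sym_diff F G) ` {F. finite F} = {F. finite F}"
    using assms by (auto intro!: image_eqI[of _ _ "sym_diff _ G"])
  then have "(\<lambda>F. fst (act F z)) ` {F. finite F} = (\<lambda>F. fst (act F z)) ` (\<lambda>F. sym_diff F G) ` {F. finite F}"
    by simp
  also have "\<dots> = (\<lambda>F. fst (act F (act G z))) ` {F. finite F}"
    unfolding image_image using assms by (intro image_cong) (simp_all add: act_act)
  finally show ?thesis
    using aperiodic_iter[of "displacement n G (snd z)" "fst z"] by (simp add: cluster_def act_def)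
qed

lemma cluster_base_map: "cluster (base_map z) = T ` cluster z"
  using aperiodic_iter[of 1 "fst z"]
  by (simp add: cluster_def act_base_map image_image) (simp add: base_map_def iter_1)

definition hits :: "'a set \<Rightarrow> ('a \<times> (nat \<Rightarrow> bool)) set" where
  "hits A = {z. cluster z \<inter> A \<noteq> {}}"

lemma measurable_fst_act [measurable]: "(\<lambda>z. fst (act F z)) \<in> marked \<rightarrow>\<^sub>M borel"
proof -
  have "(\<lambda>z. fst (act F z)) \<in> marked \<rightarrow>\<^sub>M \<mu>"
    by (rule measurable_compose[OF measurable_act measurable_fst])
  then show ?thesis by (simp cong: measurable_cong_sets[OF refl sets_\<mu>])
qed

lemma measurable_aperiodic_fst [measurable]: "Measurable.pred marked (\<lambda>z. aperiodic T (fst z))"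
  using measurable_compose[OF measurable_fst_act[of "{}"] measurable_aperiodic] by simp

lemma sets_hits [measurable]:
  assumes [measurable]: "A \<in> sets borel"
  shows "hits A \<in> sets marked"
proof -
  have "hits A = (\<Union>F\<in>{F. finite F}. {z \<in> space marked. aperiodic T (fst z) \<and> fst (act F z) \<in> A})"
    by (auto simp: hits_def cluster_def)
  also have "\<dots> \<in> sets marked"
    by (intro sets.countable_UN'' countable_finite_sets) measurable
  finally show ?thesis .
qed

lemma emeasure_cluster_Int:
  "emeasure (count_space UNIV) (cluster z \<inter> A)
    = indicator {z. aperiodic T (fst z)} z * orbit_sum (\<lambda>z. indicator A (fst z)) z"
proof (cases "aperiodic T (fst z)")
  case True
  have "cluster z \<inter> A = (\<Union>F\<in>{F. finite F}. {fst (act F z)} \<inter> A)"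
    using True by (auto simp: cluster_def)
  also have "emeasure (count_space UNIV) \<dots> = (\<integral>\<^sup>+F. emeasure (count_space UNIV) ({fst (act F z)} \<inter> A) \<partial>count_space {F. finite F})"
    using inj_on_cluster[OF True]
    by (intro emeasure_UN_countable countable_finite_sets)
       (auto simp: disjoint_family_on_def dest: inj_onD)
  also have "\<dots> = orbit_sum (\<lambda>z. indicator A (fst z)) z"
    unfolding orbit_sum_def finite_sets_def by (intro nn_integral_cong) (simp add: indicator_def)
  finally show ?thesis using True by simp
qed (simp add: cluster_def)

lemma measurable_emeasure_cluster_Int [measurable]:
  assumes [measurable]: "A \<in> sets borel"
  shows "(\<lambda>z. emeasure (count_space UNIV) (cluster z \<inter> A)) \<in> borel_measurable marked"
proof -
  have [measurable]: "(\<lambda>z. indicator A (fst z)) \<in> borel_measurable marked"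
    using measurable_compose[OF measurable_fst_act[of "{}"], of "indicator A" borel] by simp
  have [measurable]: "{z. aperiodic T (fst z)} \<in> sets marked"
    using measurable_aperiodic_fst by (simp add: pred_def)
  show ?thesis unfolding emeasure_cluster_Int by measurable
qed

lemma AE_fst:
  assumes "AE x in \<mu>. Q x"
  shows "AE z in marked. Q (fst z)"
proof -
  interpret coin: prob_space coin by (rule prob_space_coin)
  have "AE x in distr marked \<mu> fst. Q x" using assms by (simp only: coin.distr_pair_fst)
  then show ?thesis by (rule AE_distrD[rotated]) simp
qed

text \<open>The number of cluster points in \<open>A\<close>, integrated over the weighted representatives, is the measure of \<open>A\<close>:
the flips hit distinct positions, so the cluster is counted by an orbit sum.\<close>

lemma weighted_clusters:
  assumes A [measurable]: "A \<in> sets borel"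
  shows "(\<integral>\<^sup>+z. weight z * emeasure (count_space UNIV) (cluster z \<inter> A) \<partial>marked) = emeasure \<mu> A"
proof -
  interpret coin: prob_space coin by (rule prob_space_coin)
  have meas [measurable]: "(\<lambda>z. indicator A (fst z) :: ennreal) \<in> borel_measurable marked"
    using measurable_compose[OF measurable_fst_act[of "{}"], of "indicator A" borel] by simp
  have "(\<integral>\<^sup>+z. weight z * emeasure (count_space UNIV) (cluster z \<inter> A) \<partial>marked)
      = (\<integral>\<^sup>+z. weight z * orbit_sum (\<lambda>z. indicator A (fst z)) z \<partial>marked)"
    using AE_fst[OF AE_aperiodic]
    by (intro nn_integral_cong_AE) (auto simp: emeasure_cluster_Int elim!: eventually_mono)
  also have "\<dots> = (\<integral>\<^sup>+z. indicator A (fst z) \<partial>marked)" by (rule weighted_orbit_sum[OF meas])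
  also have "\<dots> = (\<integral>\<^sup>+x. indicator A x \<partial>distr marked \<mu> fst)"
    using A by (intro nn_integral_distr[symmetric]) (auto simp: sets_\<mu>)
  also have "\<dots> = emeasure \<mu> A" using A by (simp add: coin.distr_pair_fst sets_\<mu>)
  finally show ?thesis .
qed

lemma sigma_finite_marked: "sigma_finite_measure marked"
proof -
  interpret coin: prob_space coin by (rule prob_space_coin)
  interpret pair_sigma_finite \<mu> coin ..
  show ?thesis by (rule sigma_finite_measure_axioms)
qed

lemma weighted_measure:
  shows "sigma_finite_measure (density marked weight)"
    and "emeasure (density marked weight) (space (density marked weight)) \<noteq> 0"
proof -
  interpret sigma_finite_measure marked by (rule sigma_finite_marked)
  have "weight z \<noteq> \<infinity>" for z using weight_le_1[of z] by (auto simp: top_unique)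
  then show "sigma_finite_measure (density marked weight)"
    by (subst sigma_finite_iff_density_finite) auto
  show "emeasure (density marked weight) (space (density marked weight)) \<noteq> 0"
  proof
    assume "emeasure (density marked weight) (space (density marked weight)) = 0"
    moreover have "emeasure (density marked weight) UNIV = (\<integral>\<^sup>+z. weight z \<partial>marked)"
      using sets.top[of marked] by (subst emeasure_density) auto
    ultimately have "(\<integral>\<^sup>+z. weight z \<partial>marked) = 0" by simp
    then have "AE z in marked. weight z = 0" by (subst (asm) nn_integral_0_iff_AE) auto
    then have "(\<integral>\<^sup>+z. weight z * emeasure (count_space UNIV) (cluster z \<inter> UNIV) \<partial>marked) = (\<integral>\<^sup>+z. 0 \<partial>marked)"
      by (intro nn_integral_cong_AE) (auto elim!: eventually_mono)
    then show False using weighted_clusters[of UNIV] infinite by simp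
  qed
qed

end

section \<open>The Poisson process of clusters\<close>

text \<open>The representatives are sampled by a Poisson process with intensity \<open>weight \<cdot> (\<mu> \<Otimes> coin)\<close>.\<close>

locale cluster_process = cluster_system \<mu> T f n + poisson: poisson_sampling \<rho> c m
  for \<mu> :: "'a::polish_space measure" and T f n
    and \<rho> :: "('a \<times> (nat \<Rightarrow> bool)) measure" and c m +
  assumes sets_\<rho>: "sets \<rho> = sets marked"
    and \<rho>_ac: "absolutely_continuous (density marked weight) \<rho>"
    and sampled_eq: "poisson.sampled = density marked weight"
begin

lemma measurable_\<rho>_eq: "measurable \<rho> N = measurable marked N"
  by (rule measurable_cong_sets[OF sets_\<rho> refl])

definition configuration :: "(nat \<Rightarrow> nat \<times> (nat \<Rightarrow> 'a \<times> (nat \<Rightarrow> bool))) \<Rightarrow> 'a set" where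
  "configuration q = (\<Union>i\<in>{i. poisson.active i q}. cluster (poisson.point i q))"

text \<open>Orbits are countable and \<open>\<mu>\<close> has no atoms, so an independent sample does not fall on a given orbit.\<close>

lemma AE_points_on_distinct_orbits:
  "AE q in poisson.sampling. \<forall>i j. i \<noteq> j \<longrightarrow> cluster (poisson.point i q) \<inter> cluster (poisson.point j q) = {}"
proof -
  interpret \<rho>\<rho>: pair_sigma_finite \<rho> \<rho> ..
  let ?R = "\<lambda>z z' :: 'a \<times> (nat \<Rightarrow> bool). \<forall>k. iter k (fst z) \<noteq> fst z'"
  have fst_meas [measurable]: "fst \<in> \<rho> \<rightarrow>\<^sub>M borel"
    unfolding measurable_\<rho>_eq using measurable_fst_act[of "{}"] by simp
  have R_meas: "Measurable.pred (\<rho> \<Otimes>\<^sub>M \<rho>) (\<lambda>p. ?R (fst p) (snd p))" by measurable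
  have "AE z' in \<rho>. ?R z z'" for z
  proof -
    have "AE x in \<mu>. \<forall>k. x \<notin> {iter k (fst z)}"
      unfolding AE_all_countable
      by (intro allI AE_not_in) (simp add: null_sets_def sets_\<mu> emeasure_singleton)
    then have "AE z' in marked. \<forall>k. fst z' \<notin> {iter k (fst z)}" by (rule AE_fst)
    then have "AE z' in marked. ?R z z'" by (rule eventually_mono) auto
    then have "AE z' in density marked weight. ?R z z'"
      by (subst AE_density) (auto elim: eventually_mono)
    from absolutely_continuous_AE[OF _ \<rho>_ac this] show ?thesis by (simp add: sets_\<rho>)
  qed
  then have R: "AE p in \<rho> \<Otimes>\<^sub>M \<rho>. ?R (fst p) (snd p)"
    using R_meas by (intro \<rho>\<rho>.AE_pair_measure) (auto simp: pred_def)
  have "AE q in poisson.sampling. i \<noteq> j \<longrightarrow> ?R (poisson.point i q) (poisson.point j q)" for i j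
    using poisson.AE_distinct_points[OF R _ R_meas, of i j] by (cases "i = j") auto
  then have "AE q in poisson.sampling. \<forall>i j. i \<noteq> j \<longrightarrow> ?R (poisson.point i q) (poisson.point j q)"
    by (simp add: AE_all_countable)
  then show ?thesis
  proof (rule eventually_mono)
    fix q assume R: "\<forall>i j. i \<noteq> j \<longrightarrow> ?R (poisson.point i q) (poisson.point j q)"
    have "cluster z \<inter> cluster z' = {}" if "?R z z'" for z z'
    proof (rule ccontr)
      assume "cluster z \<inter> cluster z' \<noteq> {}"
      then obtain a b where "iter a (fst z) = iter b (fst z')"
        by (fastforce simp: cluster_def act_def split: if_splits)
      then have "iter (- b + a) (fst z) = iter (- b + b) (fst z')"
        unfolding int_iterate_add[OF bij_T] by simp
      then show False using that by simp
    qed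
    then show "\<forall>i j. i \<noteq> j \<longrightarrow> cluster (poisson.point i q) \<inter> cluster (poisson.point j q) = {}"
      using R by blast
  qed
qed

lemma configuration_void_iff:
  "configuration q \<inter> A = {} \<longleftrightarrow> (\<forall>i. poisson.active i q \<longrightarrow> poisson.point i q \<notin> hits A)"
  by (auto simp: configuration_def hits_def)

lemma measurable_configuration: "configuration \<in> poisson.sampling \<rightarrow>\<^sub>M void_algebra recurrent_sets"
proof (rule measurable_void_algebraI)
  show "configuration q \<in> recurrent_sets" for q
    unfolding configuration_def by (rule Union_clusters_recurrent)
  show "{q \<in> space poisson.sampling. configuration q \<inter> A = {}} \<in> sets poisson.sampling"
    if "A \<in> sets borel" for A
    unfolding configuration_void_iff using that by (intro poisson.void_event) (simp add: sets_\<rho> sets_hits)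
qed

definition law :: "'a set measure" where
  "law = distr poisson.sampling (void_algebra recurrent_sets) configuration"

lemma space_law [simp]: "space law = recurrent_sets"
  and sets_law: "sets law = sets (void_algebra recurrent_sets)"
  by (simp_all add: law_def)

lemma prob_space_law: "prob_space law"
  unfolding law_def by (intro prob_space.prob_space_distr poisson.prob_space_sampling measurable_configuration)

lemma law_void:
  assumes "A \<in> sets borel"
  shows "emeasure law {C \<in> recurrent_sets. C \<inter> A = {}}
    = ennreal (if emeasure poisson.sampled (hits A) = \<infinity> then 0
        else exp (- enn2real (emeasure poisson.sampled (hits A))))"
proof -
  interpret Q: prob_space poisson.sampling by (rule poisson.prob_space_sampling)
  have "emeasure law {C \<in> recurrent_sets. C \<inter> A = {}}
      = emeasure poisson.sampling (configuration -` {C \<in> recurrent_sets. C \<inter> A = {}} \<inter> space poisson.sampling)"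
    unfolding law_def by (rule emeasure_distr[OF measurable_configuration void_event_sets[OF assms]])
  also have "configuration -` {C \<in> recurrent_sets. C \<inter> A = {}} \<inter> space poisson.sampling
      = {q \<in> space poisson.sampling. \<forall>i. poisson.active i q \<longrightarrow> poisson.point i q \<notin> hits A}"
    using measurable_space[OF measurable_configuration] by (auto simp: configuration_void_iff)
  finally show ?thesis
    using poisson.void_probability[of "hits A"] sets_hits[OF assms]
    by (simp only: Q.emeasure_eq_measure sets_\<rho>)
qed

lemma measurable_image_T: "image T \<in> law \<rightarrow>\<^sub>M law"
proof -
  have "image T \<in> law \<rightarrow>\<^sub>M void_algebra recurrent_sets"
  proof (rule measurable_void_algebraI)
    fix A :: "'a set" assume A: "A \<in> sets borel"
    have "T -` A \<in> sets borel" using measurable_sets[OF measurable_T_borel A] by simp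
    moreover have "{C \<in> space law. T ` C \<inter> A = {}} = {C \<in> recurrent_sets. C \<inter> T -` A = {}}" by auto
    ultimately show "{C \<in> space law. T ` C \<inter> A = {}} \<in> sets law"
      by (simp only: sets_law void_event_sets)
  qed (simp add: image_T_recurrent_iff)
  then show ?thesis by (simp cong: measurable_cong_sets[OF refl sets_law])
qed

lemma measurable_image_inv_T: "(\<lambda>C. inv T ` C) \<in> law \<rightarrow>\<^sub>M law"
proof -
  have "(\<lambda>C. inv T ` C) \<in> law \<rightarrow>\<^sub>M void_algebra recurrent_sets"
  proof (rule measurable_void_algebraI)
    fix A :: "'a set" assume A: "A \<in> sets borel"
    have "inv T -` A \<in> sets borel" using measurable_sets[OF measurable_inv_T A] by simp
    moreover have "{C \<in> space law. inv T ` C \<inter> A = {}} = {C \<in> recurrent_sets. C \<inter> inv T -` A = {}}" by auto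
    ultimately show "{C \<in> space law. inv T ` C \<inter> A = {}} \<in> sets law"
      by (simp only: sets_law void_event_sets)
  next
    fix C assume "C \<in> space law"
    then show "inv T ` C \<in> recurrent_sets"
      using image_T_recurrent_iff[of "inv T ` C"] bij_T by (simp add: image_image bij_is_surj surj_f_inv_f)
  qed
  then show ?thesis by (simp cong: measurable_cong_sets[OF refl sets_law])
qed

text \<open>Replacing \<open>A\<close> by its preimage under \<open>T\<close> replaces the union of the group orbits that meet \<open>A\<close> by its preimage
under \<open>base_map\<close>, which has the same weighted measure; so all void probabilities agree.\<close>

lemma distr_image_T: "distr law law (image T) = law"
proof (rule void_algebra_measure_eqI[symmetric])
  interpret prob_space law by (rule prob_space_law)
  show "finite_measure law" by unfold_locales
  show "sets law = sets (void_algebra recurrent_sets)" "sets (distr law law (image T)) = sets (void_algebra recurrent_sets)"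
    by (simp_all add: sets_law)
  fix A :: "'a set" assume A: "A \<in> sets borel"
  then have TA: "T -` A \<in> sets borel" using measurable_sets[OF measurable_T_borel A] by simp
  have "emeasure (distr law law (image T)) {C \<in> recurrent_sets. C \<inter> A = {}}
      = emeasure law (image T -` {C \<in> recurrent_sets. C \<inter> A = {}} \<inter> space law)"
    using void_event_sets[OF A] by (intro emeasure_distr measurable_image_T) (simp add: sets_law)
  also have "image T -` {C \<in> recurrent_sets. C \<inter> A = {}} \<inter> space law = {C \<in> recurrent_sets. C \<inter> T -` A = {}}"
    by (auto simp: image_T_recurrent_iff)
  also have "emeasure law \<dots> = emeasure law {C \<in> recurrent_sets. C \<inter> A = {}}"
  proof -
    have "hits (T -` A) = base_map -` hits A"
      by (auto simp: hits_def cluster_base_map)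
    then have "emeasure poisson.sampled (hits (T -` A)) = (\<integral>\<^sup>+z. weight z * indicator (hits A) (base_map z) \<partial>marked)"
      unfolding sampled_eq using sets_hits[OF TA]
      by (subst emeasure_density) (auto intro!: nn_integral_cong simp: indicator_def)
    also have "\<dots> = (\<integral>\<^sup>+z. weight z * indicator (hits A) z \<partial>marked)"
      by (rule weighted_invariant_set[OF sets_hits[OF A]]) (simp add: hits_def cluster_act)
    also have "\<dots> = emeasure poisson.sampled (hits A)"
      unfolding sampled_eq using sets_hits[OF A] by (subst emeasure_density) auto
    finally show ?thesis by (simp only: law_void[OF A] law_void[OF TA])
  qed
  finally show "emeasure law {C \<in> recurrent_sets. C \<inter> A = {}}
    = emeasure (distr law law (image T)) {C \<in> recurrent_sets. C \<inter> A = {}}" ..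
qed

lemma invertible_mpt_image_T: "invertible_mpt law (image T)"
proof -
  have inv_image: "inv T ` T ` C = C" "T ` inv T ` C = C" for C
    using bij_T by (simp_all add: image_image bij_is_inj bij_is_surj surj_f_inv_f)
  have bij: "bij_betw (image T) recurrent_sets recurrent_sets"
  proof (rule bij_betwI[of _ _ _ "image (inv T)"])
    show "image T \<in> recurrent_sets \<rightarrow> recurrent_sets" by (simp add: image_T_recurrent_iff)
    show "image (inv T) \<in> recurrent_sets \<rightarrow> recurrent_sets"
      using measurable_space[OF measurable_image_inv_T] by auto
  qed (simp_all add: inv_image)
  have "inv_into recurrent_sets (image T) C = inv T ` C" if "C \<in> recurrent_sets" for C
  proof (rule inv_into_f_eq[OF bij_betw_imp_inj_on[OF bij]])
    show "inv T ` C \<in> recurrent_sets" using that measurable_space[OF measurable_image_inv_T] by auto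
  qed (rule inv_image)
  then have "inv_into (space law) (image T) \<in> law \<rightarrow>\<^sub>M law"
    using measurable_image_inv_T by (subst measurable_cong[of _ _ "\<lambda>C. inv T ` C"]) simp_all
  then show ?thesis
    unfolding invertible_mpt_def using bij measurable_image_T distr_image_T by simp
qed

lemma emeasure_configuration_Int:
  assumes disj: "\<forall>i j. i \<noteq> j \<longrightarrow> cluster (poisson.point i q) \<inter> cluster (poisson.point j q) = {}"
  shows "emeasure (count_space UNIV) (configuration q \<inter> A)
    = (\<integral>\<^sup>+i. (if poisson.active i q then emeasure (count_space UNIV) (cluster (poisson.point i q) \<inter> A) else 0) \<partial>count_space UNIV)"
proof -
  let ?D = "\<lambda>i. if poisson.active i q then cluster (poisson.point i q) \<inter> A else {}"
  have "configuration q \<inter> A = (\<Union>i. ?D i)" by (auto simp: configuration_def split: if_splits)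
  also have "emeasure (count_space UNIV) \<dots> = (\<integral>\<^sup>+i. emeasure (count_space UNIV) (?D i) \<partial>count_space UNIV)"
  proof (rule emeasure_UN_countable)
    show "disjoint_family_on ?D UNIV"
      unfolding disjoint_family_on_def
    proof (intro ballI impI)
      fix i j :: "nat \<times> nat" assume "i \<noteq> j"
      then show "?D i \<inter> ?D j = {}" using disj[rule_format, of i j] by auto
    qed
  qed simp_all
  finally show ?thesis by (simp add: if_distrib cong: if_cong)
qed

text \<open>As the clusters are disjoint, their points can be counted cluster by cluster.\<close>

lemma law_intensity:
  assumes A: "A \<in> sets borel"
  shows "(\<integral>\<^sup>+C. emeasure (count_space UNIV) (C \<inter> A) \<partial>law) = emeasure \<mu> A"
proof -
  let ?g = "\<lambda>z. emeasure (count_space UNIV) (cluster z \<inter> A)"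
  have g: "?g \<in> borel_measurable marked" by (rule measurable_emeasure_cluster_Int[OF A])
  then have [measurable]: "?g \<in> borel_measurable \<rho>" by (simp add: measurable_\<rho>_eq)
  have "(\<integral>\<^sup>+C. emeasure (count_space UNIV) (C \<inter> A) \<partial>law)
      = (\<integral>\<^sup>+q. emeasure (count_space UNIV) (configuration q \<inter> A) \<partial>poisson.sampling)"
    unfolding law_def using measurable_card_Int[OF A]
    by (intro nn_integral_distr measurable_configuration) simp
  also have "\<dots> = (\<integral>\<^sup>+q. \<integral>\<^sup>+i. (if poisson.active i q then ?g (poisson.point i q) else 0) \<partial>count_space UNIV \<partial>poisson.sampling)"
    using AE_points_on_distinct_orbits
    by (intro nn_integral_cong_AE) (auto elim!: eventually_mono simp: emeasure_configuration_Int)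
  also have "\<dots> = (\<integral>\<^sup>+i. \<integral>\<^sup>+q. (if poisson.active i q then ?g (poisson.point i q) else 0) \<partial>poisson.sampling \<partial>count_space UNIV)"
    by (intro nn_integral_count_space_nn_integral) measurable
  also have "\<dots> = (\<integral>\<^sup>+z. ?g z \<partial>poisson.sampled)" by (rule poisson.nn_integral_points) measurable
  also have "\<dots> = (\<integral>\<^sup>+z. weight z * ?g z \<partial>marked)"
    unfolding sampled_eq using g by (intro nn_integral_density measurable_weight)
  also have "\<dots> = emeasure \<mu> A" by (rule weighted_clusters[OF A])
  finally show ?thesis .
qed

end

section \<open>The counting process\<close>

definition locally_finite :: "'a::metric_space set \<Rightarrow> bool" where
  "locally_finite C \<longleftrightarrow> (\<forall>r::nat. finite (C \<inter> ball undefined r))"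

text \<open>Sets with infinitely many points in some ball occur with probability \<open>0\<close>; they are replaced by the empty set, so
that the values are point configurations everywhere.\<close>

definition counting_process :: "'a::metric_space set \<Rightarrow> 'a measure" where
  "counting_process C = counting (if locally_finite C then C else {})"

lemma counting_process_in_point_configurations: "counting_process C \<in> point_configurations"
  unfolding counting_process_def
  by (rule counting_in_point_configurations[where a=undefined]) (simp add: locally_finite_def)

lemma emeasure_counting_process:
  assumes "A \<in> sets borel"
  shows "emeasure (counting_process C) A = (if locally_finite C then emeasure (count_space UNIV) (C \<inter> A) else 0)"
  using assms by (simp add: counting_process_def emeasure_counting)

lemma measurable_locally_finite:
  "{C \<in> H. locally_finite (C :: 'a::{metric_space, second_countable_topology} set)} \<in> sets (void_algebra H)"
proof -
  have "{C \<in> H. locally_finite C}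
      = {C \<in> space (void_algebra H). \<forall>r::nat. emeasure (count_space UNIV) (C \<inter> ball undefined r) \<noteq> \<infinity>}"
    by (auto simp: locally_finite_def emeasure_count_space split: if_splits)
  moreover have [measurable]: "(\<lambda>C. emeasure (count_space UNIV) (C \<inter> ball undefined r)) \<in> borel_measurable (void_algebra H)"
    for r :: nat and H :: "'a set set"
    by (rule measurable_card_Int) simp
  have "{C \<in> space (void_algebra H). \<forall>r::nat. emeasure (count_space UNIV) (C \<inter> ball undefined r) \<noteq> \<infinity>} \<in> sets (void_algebra H)"
    by measurable
  ultimately show ?thesis by (simp only:)
qed

lemma measurable_emeasure_counting_process:
  fixes A :: "'a::{metric_space, second_countable_topology} set"
  assumes "A \<in> sets borel"
  shows "(\<lambda>C. emeasure (counting_process C) A) \<in> borel_measurable (void_algebra H)"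
  unfolding emeasure_counting_process[OF assms]
  by (intro measurable_If measurable_card_Int assms) (simp_all add: measurable_locally_finite)

lemma emeasure_count_space_image:
  assumes "inj_on f C"
  shows "emeasure (count_space UNIV) (f ` C) = emeasure (count_space UNIV) C"
  using assms by (simp add: emeasure_count_space finite_image_iff card_image)

context cluster_process
begin

lemma measurable_emeasure_counting_process_law:
  "A \<in> sets borel \<Longrightarrow> (\<lambda>C. emeasure (counting_process C) A) \<in> borel_measurable law"
  unfolding measurable_cong_sets[OF sets_law refl] by (rule measurable_emeasure_counting_process)

lemma AE_locally_finite: "AE C in law. locally_finite C"
proof -
  have "AE C in law. emeasure (count_space UNIV) (C \<inter> ball undefined r) \<noteq> \<infinity>" for r :: nat
  proof (rule nn_integral_PInf_AE)
    show "(\<lambda>C. emeasure (count_space UNIV) (C \<inter> ball undefined r)) \<in> borel_measurable law"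
      unfolding measurable_cong_sets[OF sets_law refl] by (rule measurable_card_Int) simp
    show "(\<integral>\<^sup>+C. emeasure (count_space UNIV) (C \<inter> ball undefined r) \<partial>law) \<noteq> \<infinity>"
      using boundedly_finite by (subst law_intensity) (auto simp: boundedly_finite_def less_top)
  qed
  then have "AE C in law. \<forall>r::nat. emeasure (count_space UNIV) (C \<inter> ball undefined r) \<noteq> \<infinity>"
    by (simp add: AE_all_countable)
  then show ?thesis
    by (rule eventually_mono) (auto simp: locally_finite_def emeasure_count_space split: if_splits)
qed

lemma counting_process_intensity:
  assumes A: "A \<in> sets borel"
  shows "(\<integral>\<^sup>+C. emeasure (counting_process C) A \<partial>law) = emeasure \<mu> A"
  unfolding law_intensity[OF A, symmetric] emeasure_counting_process[OF A]
  using AE_locally_finite by (intro nn_integral_cong_AE) (auto elim!: eventually_mono)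

lemma AE_counting_process_equivariant:
  "AE C in law. \<forall>A\<in>sets borel. emeasure (counting_process (T ` C)) A = emeasure (counting_process C) (T -` A)"
proof -
  have "AE C in distr law law (image T). locally_finite C"
    using AE_locally_finite by (simp only: distr_image_T)
  then have "AE C in law. locally_finite (T ` C)"
    by (rule AE_distrD[OF measurable_image_T])
  with AE_locally_finite show ?thesis
  proof eventually_elim
    case (elim C)
    show ?case
    proof
      fix A :: "'a set" assume A: "A \<in> sets borel"
      then have TA: "T -` A \<in> sets borel" using measurable_sets[OF measurable_T_borel A] by simp
      have "emeasure (counting_process (T ` C)) A = emeasure (count_space UNIV) (T ` C \<inter> A)"
        using elim by (simp only: emeasure_counting_process[OF A] if_True)
      also have "T ` C \<inter> A = T ` (C \<inter> T -` A)" by auto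
      also have "emeasure (count_space UNIV) \<dots> = emeasure (count_space UNIV) (C \<inter> T -` A)"
        using bij_is_inj[OF bij_T] by (intro emeasure_count_space_image) (rule inj_on_subset[OF _ subset_UNIV])
      also have "\<dots> = emeasure (counting_process C) (T -` A)"
        using elim by (simp only: emeasure_counting_process[OF TA] if_True)
      finally show "emeasure (counting_process (T ` C)) A = emeasure (counting_process C) (T -` A)" .
    qed
  qed
qed

lemma counting_process_infinite_on_orbits:
  assumes "C \<in> recurrent_sets" "emeasure (counting_process C) {x} = 1"
  shows "emeasure (counting_process C) (range (\<lambda>k. iter k x)) = \<infinity>"
proof -
  have lf: "locally_finite C" and "x \<in> C"
    using assms(2) by (cases "x \<in> C"; simp add: emeasure_counting_process split: if_splits)+
  then have "infinite (C \<inter> range (\<lambda>k. iter k x))"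
    using assms(1) unfolding recurrent_sets_def by blast
  moreover have "range (\<lambda>k. iter k x) \<in> sets borel"
    by (rule sets.countable) auto
  ultimately show ?thesis using lf by (simp add: emeasure_counting_process)
qed

end

section \<open>Moving a dynamical system along an injection\<close>

text \<open>An isomorphic copy of \<open>P\<close>. The carrier is only the range of \<open>e\<close> on the space of \<open>P\<close>, because the conjugate of a
bijection by \<open>e\<close> is a bijection there and need not be one on the whole target type.\<close>

definition transport :: "('b \<Rightarrow> 'w) \<Rightarrow> 'b measure \<Rightarrow> 'w measure" where
  "transport e P = distr P (vimage_algebra (e ` space P) (inv e) P) e"

lemma
  assumes e: "inj e"
  shows space_transport [simp]: "space (transport e P) = e ` space P"
    and measurable_transport_inv: "inv e \<in> transport e P \<rightarrow>\<^sub>M P"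
    and measurable_transport: "e \<in> P \<rightarrow>\<^sub>M transport e P"
    and distr_transport: "distr P (transport e P) e = transport e P"
    and distr_transport_inv: "distr (transport e P) P (inv e) = P"
proof -
  let ?V = "vimage_algebra (e ` space P) (inv e) P"
  have s: "sets (transport e P) = sets ?V" unfolding transport_def by simp
  show sp: "space (transport e P) = e ` space P" unfolding transport_def by simp
  show d: "inv e \<in> transport e P \<rightarrow>\<^sub>M P"
    unfolding measurable_cong_sets[OF s refl]
    by (rule measurable_vimage_algebra1) (auto simp: e)
  show m: "e \<in> P \<rightarrow>\<^sub>M transport e P"
    unfolding measurable_cong_sets[OF refl s]
    by (rule measurable_vimage_algebra2) (auto simp: e)
  show d2: "distr P (transport e P) e = transport e P"
    unfolding transport_def by (rule distr_cong) auto
  have "distr (transport e P) P (inv e) = distr (distr P (transport e P) e) P (inv e)"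
    by (simp add: d2)
  also have "\<dots> = distr P P (inv e \<circ> e)"
    using m d by (rule distr_distr[rotated])
  also have "inv e \<circ> e = (\<lambda>x. x)" using e by auto
  finally show "distr (transport e P) P (inv e) = P" by simp
qed

lemma invertible_mpt_transport:
  assumes e: "inj e" and S: "invertible_mpt P S"
  shows "invertible_mpt (transport e P) (e \<circ> S \<circ> inv e)"
proof -
  note m = measurable_transport[OF e, of P] and d = measurable_transport_inv[OF e, of P]
  let ?S = "e \<circ> S \<circ> inv e" and ?R = "inv_into (space P) S"
  have bij: "bij_betw S (space P) (space P)" and S_meas: "S \<in> P \<rightarrow>\<^sub>M P"
    and R_meas: "?R \<in> P \<rightarrow>\<^sub>M P" and S_distr: "distr P P S = P"
    using S by (auto simp: invertible_mpt_def)
  have b1: "bij_betw (inv e) (e ` space P) (space P)" and b2: "bij_betw e (space P) (e ` space P)"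
    using e by (auto simp: bij_betw_def inj_on_def image_image)
  have bij': "bij_betw ?S (space (transport e P)) (space (transport e P))"
    using bij_betw_trans[OF bij_betw_trans[OF b1 bij] b2] e by (simp add: comp_assoc)
  have S'_meas: "?S \<in> transport e P \<rightarrow>\<^sub>M transport e P"
    using d S_meas m by (intro measurable_comp)
  have inv: "inv_into (space (transport e P)) ?S y = (e \<circ> ?R \<circ> inv e) y" if "y \<in> space (transport e P)" for y
  proof (rule inv_into_f_eq[OF bij_betw_imp_inj_on[OF bij']])
    have y: "inv e y \<in> space P" "e (inv e y) = y" using that e by auto
    have Ry: "?R (inv e y) \<in> space P" using bij y by (metis bij_betw_def inv_into_into)
    then show "(e \<circ> ?R \<circ> inv e) y \<in> space (transport e P)" using e by simp
    show "?S ((e \<circ> ?R \<circ> inv e) y) = y"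
      using e y bij by (simp add: bij_betw_inv_into_right)
  qed
  have "(e \<circ> ?R \<circ> inv e) \<in> transport e P \<rightarrow>\<^sub>M transport e P"
    using d R_meas m by (intro measurable_comp)
  then have R'_meas: "inv_into (space (transport e P)) ?S \<in> transport e P \<rightarrow>\<^sub>M transport e P"
    by (rule measurable_cong[THEN iffD2, rotated]) (rule inv)
  have "distr (transport e P) (transport e P) ?S = distr (distr P (transport e P) e) (transport e P) ?S"
    by (simp add: distr_transport[OF e])
  also have "\<dots> = distr P (transport e P) (?S \<circ> e)"
    by (rule distr_distr[OF S'_meas m])
  also have "?S \<circ> e = e \<circ> S" using e by auto
  also have "distr P (transport e P) (e \<circ> S) = distr (distr P P S) (transport e P) e"
    by (rule distr_distr[OF m S_meas, symmetric])
  also have "\<dots> = transport e P" by (simp add: S_distr distr_transport[OF e])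
  finally show ?thesis
    unfolding invertible_mpt_def using bij' S'_meas R'_meas by blast
qed

text \<open>A set is recovered from its count space as the carrier.\<close>

lemma inj_sample_of_set: "inj (\<lambda>C :: 'a set. count_space (C \<times> {\<lambda>_::nat. 0::real}))"
proof (rule injI)
  fix C D :: "'a set"
  assume "count_space (C \<times> {\<lambda>_::nat. 0::real}) = count_space (D \<times> {\<lambda>_. 0})"
  then have "C \<times> {\<lambda>_::nat. 0::real} = D \<times> {\<lambda>_. 0}" by (metis space_count_space)
  then show "C = D" by auto
qed

section \<open>Existence of the process\<close>

theorem proposition2p2:
  fixes \<mu> :: "'a::polish_space measure" and T :: "'a \<Rightarrow> 'a"
  assumes "sets \<mu> = sets borel"
    and "boundedly_finite \<mu>"
    and "invertible_mpt \<mu> T"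
    and "ergodic_map \<mu> T"
    and "conservative_map \<mu> T"
    and "emeasure \<mu> UNIV = \<infinity>"
  shows "\<exists>(P :: 'a sample measure) S N.
     point_process \<mu> T P S N \<and> intensity P N = \<mu> \<and>
     (AE \<omega> in P. \<forall>x. emeasure (N \<omega>) {x} = 1 \<longrightarrow>
        emeasure (N \<omega>) (range (\<lambda>k::int. int_iterate T k x)) = \<infinity>)"
proof -
  interpret infinite_system \<mu> T
    using assms by (simp add: infinite_system_def)
  obtain f where f: "integrable \<mu> f" "\<And>x. 0 < f x" "\<And>x. 0 \<le> f x" "\<And>x. f x \<le> (1::real)"
    using obtain_positive_integrable by (metis UNIV_I space_\<mu>)
  obtain n where n: "\<And>i. (\<Sum>l<i. n l) < n i"
    "\<And>i s. \<bar>s\<bar> \<le> int (\<Sum>l<i. n l) \<Longrightarrow> correlation f (int (n i) + s) \<le> ennreal ((1 / 4) ^ i)"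
    using obtain_sparse_times[OF f(1,3,4)] by blast
  interpret cluster_system \<mu> T f n
    by unfold_locales (use f n in auto)
  obtain \<rho> c m where \<rho>: "poisson_sampling \<rho> c m" "sets \<rho> = sets (density marked weight)"
    "absolutely_continuous (density marked weight) \<rho>"
    "poisson_sampling.sampled \<rho> c m = density marked weight"
    using sigma_finite_measure.obtain_poisson_sampling[OF weighted_measure] by blast
  interpret cluster_process \<mu> T f n \<rho> c m
    by (intro cluster_process.intro cluster_process_axioms.intro cluster_system_axioms \<rho>(1))
       (use \<rho> in auto)
  define e :: "'a set \<Rightarrow> 'a sample" where "e C = count_space (C \<times> {\<lambda>_. 0})" for C
  have e: "inj e" unfolding e_def by (rule inj_sample_of_set)
  define P where "P = transport e law"
  define S where "S = e \<circ> image T \<circ> inv e"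
  define N where "N = counting_process \<circ> inv e"
  have d: "inv e \<in> P \<rightarrow>\<^sub>M law" unfolding P_def by (rule measurable_transport_inv[OF e])
  have law_P: "distr P law (inv e) = law" unfolding P_def by (rule distr_transport_inv[OF e])
  have AE_P: "AE \<omega> in P. Q (inv e \<omega>)" if "AE C in law. Q C" for Q
  proof -
    have "AE C in distr P law (inv e). Q C" using that by (simp only: law_P)
    then show ?thesis by (rule AE_distrD[OF d])
  qed
  have "prob_space (distr law (transport e law) e)"
    by (intro prob_space.prob_space_distr prob_space_law measurable_transport e)
  then have P: "prob_space P" by (simp only: P_def distr_transport[OF e])
  have N_meas: "(\<lambda>\<omega>. emeasure (N \<omega>) A) \<in> borel_measurable P" if "A \<in> sets borel" for A
    using measurable_compose[OF d measurable_emeasure_counting_process_law[OF that]] by (simp add: N_def)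
  have N_int: "(\<integral>\<^sup>+\<omega>. emeasure (N \<omega>) A \<partial>P) = emeasure \<mu> A" if "A \<in> sets borel" for A
    using nn_integral_distr[OF d, of "\<lambda>C. emeasure (counting_process C) A"]
      measurable_emeasure_counting_process_law[OF that] counting_process_intensity[OF that]
    by (simp add: law_P N_def)
  have "point_process \<mu> T P S N"
    unfolding point_process_def
  proof (intro conjI)
    show "invertible_mpt P S"
      unfolding P_def S_def by (rule invertible_mpt_transport[OF e invertible_mpt_image_T])
    show "N \<in> P \<rightarrow>\<^sub>M configuration_algebra"
      unfolding N_def comp_def
      by (rule measurable_configuration_algebra[OF counting_process_in_point_configurations N_meas[unfolded N_def comp_def]])
    show "\<forall>A\<in>sets borel. emeasure \<mu> A = 0 \<longrightarrow> (AE \<omega> in P. emeasure (N \<omega>) A = 0)"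
    proof (intro ballI impI)
      fix A :: "'a set" assume A: "A \<in> sets borel" "emeasure \<mu> A = 0"
      then have "(\<integral>\<^sup>+\<omega>. emeasure (N \<omega>) A \<partial>P) = 0" by (simp only: N_int)
      then show "AE \<omega> in P. emeasure (N \<omega>) A = 0"
        by (simp only: nn_integral_0_iff_AE[OF N_meas[OF A(1)]])
    qed
    show "AE \<omega> in P. \<forall>A\<in>sets borel. emeasure (N (S \<omega>)) A = emeasure (N \<omega>) (T -` A)"
      using AE_P[OF AE_counting_process_equivariant] e by (simp add: N_def S_def)
  qed (rule P)
  moreover have "intensity P N = \<mu>"
  proof -
    have "intensity P N = measure_of UNIV (sets borel) (emeasure \<mu>)"
      unfolding intensity_def
      by (rule measure_of_eq) (simp_all add: N_int sets.sigma_sets_eq[of borel, simplified])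
    also have "\<dots> = \<mu>" using measure_of_of_measure[of \<mu>] by (simp add: sets_\<mu>)
    finally show ?thesis .
  qed
  moreover have "AE \<omega> in P. \<forall>x. emeasure (N \<omega>) {x} = 1 \<longrightarrow> emeasure (N \<omega>) (range (\<lambda>k. iter k x)) = \<infinity>"
  proof -
    have "AE C in law. \<forall>x. emeasure (counting_process C) {x} = 1 \<longrightarrow>
        emeasure (counting_process C) (range (\<lambda>k. iter k x)) = \<infinity>"
      by (intro AE_I2 allI impI counting_process_infinite_on_orbits) simp_all
    from AE_P[OF this] show ?thesis by (simp only: N_def comp_def)
  qed
  ultimately show ?thesis by (intro exI[of _ P] exI[of _ S] exI[of _ N] conjI)
qed

end
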